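(* Let $\lambda\in\Lambda^+_{m|n}$. (1) Let $\Sigma,\Sigma'\in\mathbb S$ and $\alpha\in\Sigma\cap\Sigma'\cap\mathcal R$. If $D^{r_\alpha\Sigma}_\lambda\ne D^{\Sigma}_\lambda$, then $D^{r_\alpha\Sigma'}_\lambda\neq D^{\Sigma'}_\lambda$. (2) Let $1\le i\le m$, $1\le j\le n$. The following are equivalent: (a) for every base $\Sigma\in\mathbb S$ with $\varepsilon_i-\delta_j\in\Sigma$, one has $D^{r_{\varepsilon_i-\delta_j}\Sigma}_\lambda\ne D^{\Sigma}_\lambda$; (b) $M_i-(k_i-\overline\lambda_i-1)\le j\le M_i$.
   Context: Fix $m,n\ge 0$ and the complex Lie superalgebra $\mathfrak{gl}(m|n)$ with Cartan subalgebra $\mathfrak h$ of diagonal matrices. Let $\varepsilon_1,\dots,\varepsilon_m,\delta_1,\dots,\delta_n$ be the basis of $\mathfrak h^*$ dual to $E_{1,1},\dots,E_{m+n,m+n}$, with the symmetric bilinear form such that this basis is orthogonal, $(\varepsilon_i|\varepsilon_i)=1$, $(\delta_j|\delta_j)=-1$. The root system $\Delta$ consists of the even roots $\varepsilon_i-\varepsilon_j$, $\delta_i-\delta_j$ ($i\ne j$) and the odd roots $\pm(\varepsilon_i-\delta_j)$. A base is a linearly independent $\Sigma\subset\Delta$ such that every root is an integer combination of elements of $\Sigma$ with all coefficients $\ge0$ (positive roots for $\Sigma$) or all $\le 0$. The distinguished base is $\Sigma^{\mathrm{dist}}=\{\varepsilon_i-\varepsilon_{i+1},\ \varepsilon_m-\delta_1,\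 \delta_j-\delta_{j+1}\}$. $\mathbb S$ is the set of bases whose positive even roots are exactly $\{\varepsilon_i-\varepsilon_j,\delta_i-\delta_j\mid i<j\}$. Right odd roots: $\mathcal R=\{\varepsilon_i-\delta_j\mid 1\le i\le m,1\le j\le n\}$. Odd reflection: for an odd root $\alpha\in\Sigma$, $r_\alpha\Sigma$ is the base consisting of $-\alpha$, of all $\beta\in\Sigma\setminus\{\alpha\}$ with $(\beta|\alpha)=0$, and of $\beta+\alpha$ for $\beta\in\Sigma\setminus\{\alpha\}$ with $(\beta|\alpha)\ne0$. Weights: $\nu=\sum a_i\varepsilon_i+\sum b_j\delta_j$ is written $(a_1\dots a_m|b_1\dots b_n)$, with $\nu_i:=a_i$, $\nu_{-j}:=b_j$. $\Lambda^+_{m|n}$ is the set of weights $\lambda$ with integer coordinates, $\lambda_1\ge\dots\ge\lambda_m$ and $\lambda_{-1}\ge\dots\ge\lambda_{-n}$. $L(\lambda)$ is the simple finite-dimensional $\mathfrak{gl}(m|n)$-module with highest weight $\lambda$ with respect to $\Sigma^{\mathrm{dist}}$; $\lambda_\Sigma$ is the highest weight of $L(\lambda)$ with respect to the base $\Sigma$. $\rho_\Sigma$ is half the sum of positive even roots minus half the sum of positive odd roots for $\Sigma$, shifted by $r(1\dots1|-1\dots-1)$ with $r\in\{0,\tfrac12\}$ (depending only on $m+n$) so that its coordinates are integers. $\overline\lambda_\Sigma:=\lambda_\Sigma+\rho_\Sigma$ and $\overline\lambda:=\overline\lambda_{\Sigma^{\mathrm{dist}}}$. Weight diagram $D^\Sigma_\lambda$: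 a function assigning to each $p\in\mathbb Z$ a finite collection of symbols. With $k=\#\{i:(\overline\lambda_\Sigma)_i=p\}$ and $s=\#\{j:(\overline\lambda_\Sigma)_{-j}=-p\}$, $D^\Sigma_\lambda(p)$ consists of $\min(k,s)$ symbols $\times$, together with $k-s$ symbols $>$ if $k>s$, or $s-k$ symbols $<$ if $s>k$; if $k=s=0$ it is the single symbol $\circ$. Arrow diagram: define recursively for $i=m,m-1,\dots,1$ $$k_i:=\min\{c\in\mathbb Z\mid c\ge\overline\lambda_i,\ c\ne-\overline\lambda_{-j}\ \forall 1\le j\le n,\ c\ne k_{i'}\ \forall i<i'\le m\}$$ (the endpoint of the arrow starting at $\overline\lambda_i$), and $M_i:=\#\{j\in\{1,\dots,n\}\mid-\overline\lambda_{-j}<k_i\}$. *)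

theory Defs
  imports Complex_Main "HOL-Library.Multiset" "HOL-Library.Function_Algebras"
begin

section \<open>Weights and roots\<close>

text \<open>
  Coordinates are indexed by the integers: the index \<open>i\<close> with \<open>1 \<le> i \<le> m\<close> belongs to
  \<open>\<epsilon>\<^sub>i\<close>, and the index \<open>-j\<close> with \<open>1 \<le> j \<le> n\<close> belongs to \<open>\<delta>\<^sub>j\<close>. In the same way \<open>-j\<close> labels
  row and column \<open>m + j\<close> of a matrix. An element of the dual of the Cartan subalgebra is its
  coordinate function, which vanishes outside the index set.
\<close>

type_synonym weight = "int \<Rightarrow> complex"

definition idx :: "nat \<Rightarrow> nat \<Rightarrow> int set" where
  "idx m n = {1..int m} \<union> {- int n..-1}"

definition weights :: "nat \<Rightarrow> nat \<Rightarrow> weight set" where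
  "weights m n = {\<mu>. \<forall>a. a \<notin> idx m n \<longrightarrow> \<mu> a = 0}"

definition weight_scale :: "complex \<Rightarrow> weight \<Rightarrow> weight" where
  "weight_scale c \<mu> = (\<lambda>a. c * \<mu> a)"

definition eps :: "int \<Rightarrow> weight" where
  "eps i = (\<lambda>a. if a = i then 1 else 0)"

definition delta :: "int \<Rightarrow> weight" where
  "delta j = (\<lambda>a. if a = - j then 1 else 0)"

definition form :: "nat \<Rightarrow> nat \<Rightarrow> weight \<Rightarrow> weight \<Rightarrow> complex" where
  "form m n \<mu> \<nu> = (\<Sum>i\<in>{1..int m}. \<mu> i * \<nu> i) - (\<Sum>j\<in>{1..int n}. \<mu> (- j) * \<nu> (- j))"

definition even_roots :: "nat \<Rightarrow> nat \<Rightarrow> weight set" where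
  "even_roots m n =
     {eps i - eps j | i j. i \<in> {1..int m} \<and> j \<in> {1..int m} \<and> i \<noteq> j} \<union>
     {delta i - delta j | i j. i \<in> {1..int n} \<and> j \<in> {1..int n} \<and> i \<noteq> j}"

definition right_odd_roots :: "nat \<Rightarrow> nat \<Rightarrow> weight set" where
  "right_odd_roots m n = {eps i - delta j | i j. i \<in> {1..int m} \<and> j \<in> {1..int n}}"

definition odd_roots :: "nat \<Rightarrow> nat \<Rightarrow> weight set" where
  "odd_roots m n = right_odd_roots m n \<union> uminus ` right_odd_roots m n"

definition roots :: "nat \<Rightarrow> nat \<Rightarrow> weight set" where
  "roots m n = even_roots m n \<union> odd_roots m n"


section \<open>Bases and odd reflections\<close>

definition nonneg_comb :: "weight set \<Rightarrow> weight \<Rightarrow> bool" where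
  "nonneg_comb \<Sigma> \<alpha> \<longleftrightarrow>
     (\<exists>c :: weight \<Rightarrow> int. (\<forall>\<beta>\<in>\<Sigma>. c \<beta> \<ge> 0) \<and> \<alpha> = (\<Sum>\<beta>\<in>\<Sigma>. weight_scale (of_int (c \<beta>)) \<beta>))"

definition nonpos_comb :: "weight set \<Rightarrow> weight \<Rightarrow> bool" where
  "nonpos_comb \<Sigma> \<alpha> \<longleftrightarrow>
     (\<exists>c :: weight \<Rightarrow> int. (\<forall>\<beta>\<in>\<Sigma>. c \<beta> \<le> 0) \<and> \<alpha> = (\<Sum>\<beta>\<in>\<Sigma>. weight_scale (of_int (c \<beta>)) \<beta>))"

definition is_base :: "nat \<Rightarrow> nat \<Rightarrow> weight set \<Rightarrow> bool" where
  "is_base m n \<Sigma> \<longleftrightarrow>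
     \<Sigma> \<subseteq> roots m n \<and> \<not> module.dependent weight_scale \<Sigma> \<and>
     (\<forall>\<alpha>\<in>roots m n. nonneg_comb \<Sigma> \<alpha> \<or> nonpos_comb \<Sigma> \<alpha>)"

definition pos_roots :: "nat \<Rightarrow> nat \<Rightarrow> weight set \<Rightarrow> weight set" where
  "pos_roots m n \<Sigma> = {\<alpha> \<in> roots m n. nonneg_comb \<Sigma> \<alpha>}"

definition dist_base :: "nat \<Rightarrow> nat \<Rightarrow> weight set" where
  "dist_base m n =
     {eps i - eps (i + 1) | i. 1 \<le> i \<and> i < int m} \<union>
     (if 1 \<le> m \<and> 1 \<le> n then {eps (int m) - delta 1} else {}) \<union>
     {delta j - delta (j + 1) | j. 1 \<le> j \<and> j < int n}"

definition std_bases :: "nat \<Rightarrow> nat \<Rightarrow> weight set set" where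
  "std_bases m n =
     {\<Sigma>. is_base m n \<Sigma> \<and>
        pos_roots m n \<Sigma> \<inter> even_roots m n =
          {eps i - eps j | i j. 1 \<le> i \<and> i < j \<and> j \<le> int m} \<union>
          {delta i - delta j | i j. 1 \<le> i \<and> i < j \<and> j \<le> int n}}"

definition odd_reflection :: "nat \<Rightarrow> nat \<Rightarrow> weight \<Rightarrow> weight set \<Rightarrow> weight set" where
  "odd_reflection m n \<alpha> \<Sigma> =
     {- \<alpha>} \<union> {\<beta> \<in> \<Sigma> - {\<alpha>}. form m n \<beta> \<alpha> = 0} \<union>
     {\<beta> + \<alpha> | \<beta>. \<beta> \<in> \<Sigma> - {\<alpha>} \<and> form m n \<beta> \<alpha> \<noteq> 0}"

text \<open>
  Half the sum of the positive even roots minus half the sum of the positive odd roots has all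
  coordinates in \<open>(m + n - 1) / 2 + \<int>\<close>, so the shift is by \<open>1/2\<close> exactly when \<open>m + n\<close> is even.
\<close>

definition rho_shift :: "nat \<Rightarrow> nat \<Rightarrow> weight" where
  "rho_shift m n = (let r = (if even (m + n) then 1 / 2 else 0) in
     (\<lambda>a. if a \<in> {1..int m} then r else if a \<in> {- int n..-1} then - r else 0))"

definition rho :: "nat \<Rightarrow> nat \<Rightarrow> weight set \<Rightarrow> weight" where
  "rho m n \<Sigma> =
     weight_scale (1 / 2) (\<Sum>\<alpha>\<in>pos_roots m n \<Sigma> \<inter> even_roots m n. \<alpha>)
     - weight_scale (1 / 2) (\<Sum>\<alpha>\<in>pos_roots m n \<Sigma> \<inter> odd_roots m n. \<alpha>)
     + rho_shift m n"


section \<open>The Lie superalgebra \<open>gl(m|n)\<close> and its modules\<close>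

type_synonym supermatrix = "int \<Rightarrow> int \<Rightarrow> complex"

definition gl :: "nat \<Rightarrow> nat \<Rightarrow> supermatrix set" where
  "gl m n = {X. \<forall>a b. X a b \<noteq> 0 \<longrightarrow> a \<in> idx m n \<and> b \<in> idx m n}"

text \<open>Parities are Booleans, with \<open>True\<close> for odd; addition of parities is \<open>\<noteq>\<close>.\<close>

definition gl_part :: "nat \<Rightarrow> nat \<Rightarrow> bool \<Rightarrow> supermatrix set" where
  "gl_part m n p = {X \<in> gl m n. \<forall>a b. X a b \<noteq> 0 \<longrightarrow> ((a < 0) \<noteq> (b < 0)) = p}"

definition mat_mult :: "nat \<Rightarrow> nat \<Rightarrow> supermatrix \<Rightarrow> supermatrix \<Rightarrow> supermatrix" where
  "mat_mult m n X Y = (\<lambda>a b. \<Sum>c\<in>idx m n. X a c * Y c b)"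

definition super_sign :: "bool \<Rightarrow> bool \<Rightarrow> complex" where
  "super_sign p q = (if p \<and> q then -1 else 1)"

text \<open>The superbracket of \<open>X\<close> of parity \<open>p\<close> with \<open>Y\<close> of parity \<open>q\<close>.\<close>

definition super_bracket ::
    "nat \<Rightarrow> nat \<Rightarrow> bool \<Rightarrow> bool \<Rightarrow> supermatrix \<Rightarrow> supermatrix \<Rightarrow> supermatrix" where
  "super_bracket m n p q X Y =
     (\<lambda>a b. mat_mult m n X Y a b - super_sign p q * mat_mult m n Y X a b)"

definition elem_mat :: "int \<Rightarrow> int \<Rightarrow> supermatrix" where
  "elem_mat a b = (\<lambda>c d. if c = a \<and> d = b then 1 else 0)"

text \<open>
  The underlying space of a module is the whole type \<open>'v\<close>, with scalar multiplication \<open>scale\<close>;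
  \<open>V p\<close> is its homogeneous part of parity \<open>p\<close>. Only the values of \<open>act\<close> on \<open>gl m n\<close> matter.
\<close>

locale gl_supermodule = vector_space scale
  for scale :: "complex \<Rightarrow> 'v::ab_group_add \<Rightarrow> 'v" +
  fixes m n :: nat
    and V :: "bool \<Rightarrow> 'v set"
    and act :: "supermatrix \<Rightarrow> 'v \<Rightarrow> 'v"
  assumes subspace_part: "\<And>p. subspace (V p)"
    and parts_disjoint: "V False \<inter> V True = {0}"
    and parts_span: "\<And>v. \<exists>v0\<in>V False. \<exists>v1\<in>V True. v = v0 + v1"
    and act_linear: "\<And>X. X \<in> gl m n \<Longrightarrow> Vector_Spaces.linear scale scale (act X)"
    and act_add: "\<And>X Y v. X \<in> gl m n \<Longrightarrow> Y \<in> gl m n \<Longrightarrow>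
          act (\<lambda>a b. X a b + Y a b) v = act X v + act Y v"
    and act_scale: "\<And>c X v. X \<in> gl m n \<Longrightarrow> act (\<lambda>a b. c * X a b) v = scale c (act X v)"
    and act_parity: "\<And>p q X v. X \<in> gl_part m n p \<Longrightarrow> v \<in> V q \<Longrightarrow> act X v \<in> V (p \<noteq> q)"
    and act_bracket: "\<And>p q X Y v. X \<in> gl_part m n p \<Longrightarrow> Y \<in> gl_part m n q \<Longrightarrow>
          act (super_bracket m n p q X Y) v =
            act X (act Y v) - scale (super_sign p q) (act Y (act X v))"

definition gl_submodule ::
    "(complex \<Rightarrow> 'v::ab_group_add \<Rightarrow> 'v) \<Rightarrow> nat \<Rightarrow> nat \<Rightarrow> (bool \<Rightarrow> 'v set) \<Rightarrow>
     (supermatrix \<Rightarrow> 'v \<Rightarrow> 'v) \<Rightarrow> 'v set \<Rightarrow> bool" where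
  "gl_submodule scale m n V act W \<longleftrightarrow>
     module.subspace scale W \<and>
     (\<forall>w\<in>W. \<exists>w0\<in>W \<inter> V False. \<exists>w1\<in>W \<inter> V True. w = w0 + w1) \<and>
     (\<forall>X\<in>gl m n. \<forall>w\<in>W. act X w \<in> W)"

definition simple_fd_gl_supermodule ::
    "(complex \<Rightarrow> 'v::ab_group_add \<Rightarrow> 'v) \<Rightarrow> nat \<Rightarrow> nat \<Rightarrow> (bool \<Rightarrow> 'v set) \<Rightarrow>
     (supermatrix \<Rightarrow> 'v \<Rightarrow> 'v) \<Rightarrow> bool" where
  "simple_fd_gl_supermodule scale m n V act \<longleftrightarrow>
     gl_supermodule scale m n V act \<and>
     (\<exists>B. finite B \<and> module.span scale B = UNIV) \<and>
     (UNIV :: 'v set) \<noteq> {0} \<and>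
     (\<forall>W. gl_submodule scale m n V act W \<longrightarrow> W = {0} \<or> W = UNIV)"

text \<open>
  The root space of the root with coordinate \<open>1\<close> at \<open>a\<close> and \<open>-1\<close> at \<open>b\<close> (\<open>a \<noteq> b\<close>) is spanned by
  \<open>elem_mat a b\<close>.
\<close>

definition root_of :: "int \<Rightarrow> int \<Rightarrow> weight" where
  "root_of a b = (\<lambda>c. (if c = a then 1 else 0) - (if c = b then 1 else 0))"

definition has_highest_weight ::
    "(complex \<Rightarrow> 'v::ab_group_add \<Rightarrow> 'v) \<Rightarrow> nat \<Rightarrow> nat \<Rightarrow> (supermatrix \<Rightarrow> 'v \<Rightarrow> 'v) \<Rightarrow>
     weight set \<Rightarrow> weight \<Rightarrow> bool" where
  "has_highest_weight scale m n act \<Sigma> \<mu> \<longleftrightarrow>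
     \<mu> \<in> weights m n \<and>
     (\<exists>v. v \<noteq> 0 \<and>
        (\<forall>a\<in>idx m n. act (elem_mat a a) v = scale (\<mu> a) v) \<and>
        (\<forall>a\<in>idx m n. \<forall>b\<in>idx m n. root_of a b \<in> pos_roots m n \<Sigma> \<longrightarrow> act (elem_mat a b) v = 0))"

definition highest_weight ::
    "(complex \<Rightarrow> 'v::ab_group_add \<Rightarrow> 'v) \<Rightarrow> nat \<Rightarrow> nat \<Rightarrow> (supermatrix \<Rightarrow> 'v \<Rightarrow> 'v) \<Rightarrow>
     weight set \<Rightarrow> weight" where
  "highest_weight scale m n act \<Sigma> = (THE \<mu>. has_highest_weight scale m n act \<Sigma> \<mu>)"

definition dominant_weights :: "nat \<Rightarrow> nat \<Rightarrow> weight set" where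
  "dominant_weights m n =
     {\<nu> \<in> weights m n. (\<forall>a\<in>idx m n. \<nu> a \<in> \<int>) \<and>
        (\<forall>i. 1 \<le> i \<and> i < int m \<longrightarrow> Re (\<nu> i) \<ge> Re (\<nu> (i + 1))) \<and>
        (\<forall>j. 1 \<le> j \<and> j < int n \<longrightarrow> Re (\<nu> (- j)) \<ge> Re (\<nu> (- (j + 1))))}"

text \<open>
  The weight \<open>\<lambda>\<^sub>\<Sigma> + \<rho>\<^sub>\<Sigma>\<close>, where the weight \<open>\<lambda>\<close> is represented by the simple module \<open>L(\<lambda>)\<close>.
\<close>

definition shifted_highest_weight ::
    "(complex \<Rightarrow> 'v::ab_group_add \<Rightarrow> 'v) \<Rightarrow> nat \<Rightarrow> nat \<Rightarrow> (supermatrix \<Rightarrow> 'v \<Rightarrow> 'v) \<Rightarrow>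
     weight set \<Rightarrow> weight" where
  "shifted_highest_weight scale m n act \<Sigma> = highest_weight scale m n act \<Sigma> + rho m n \<Sigma>"


section \<open>Weight diagrams and arrow diagrams\<close>

datatype diagram_symbol = Times | Greater | Less | Circ

definition diagram_of :: "nat \<Rightarrow> nat \<Rightarrow> weight \<Rightarrow> int \<Rightarrow> diagram_symbol multiset" where
  "diagram_of m n \<mu> p =
     (let k = card {i \<in> {1..int m}. \<mu> i = of_int p};
          s = card {j \<in> {1..int n}. \<mu> (- j) = - of_int p}
      in if k = 0 \<and> s = 0 then {#Circ#}
         else replicate_mset (min k s) Times + replicate_mset (k - s) Greater +
              replicate_mset (s - k) Less)"

definition weight_diagram ::
    "(complex \<Rightarrow> 'v::ab_group_add \<Rightarrow> 'v) \<Rightarrow> nat \<Rightarrow> nat \<Rightarrow> (supermatrix \<Rightarrow> 'v \<Rightarrow> 'v) \<Rightarrow>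
     weight set \<Rightarrow> int \<Rightarrow> diagram_symbol multiset" where
  "weight_diagram scale m n act \<Sigma> = diagram_of m n (shifted_highest_weight scale m n act \<Sigma>)"

text \<open>The coordinates of a weight as integers; meaningful only for weights with integer coordinates.\<close>

definition int_coord :: "weight \<Rightarrow> int \<Rightarrow> int" where
  "int_coord \<mu> a = \<lfloor>Re (\<mu> a)\<rfloor>"

function arrow_end :: "nat \<Rightarrow> nat \<Rightarrow> (int \<Rightarrow> int) \<Rightarrow> int \<Rightarrow> int" where
  "arrow_end m n x i =
     (LEAST c. c \<ge> x i \<and> (\<forall>j\<in>{1..int n}. c \<noteq> - x (- j)) \<and> c \<notin> arrow_end m n x ` {i<..int m})"
  by pat_completeness auto
termination
  by (relation "measure (\<lambda>(m, n, x, i). nat (int m - i))") auto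

declare arrow_end.simps [simp del]

definition arrow_count :: "nat \<Rightarrow> nat \<Rightarrow> (int \<Rightarrow> int) \<Rightarrow> int \<Rightarrow> nat" where
  "arrow_count m n x i = card {j \<in> {1..int n}. - x (- j) < arrow_end m n x i}"

end

theory Submission
  imports Defs
begin

text \<open>
  A base in \<open>std_bases\<close> is a shuffle of the sequences \<open>\<epsilon>\<^sub>1, \<dots>, \<epsilon>\<^sub>m\<close> and \<open>\<delta>\<^sub>1, \<dots>, \<delta>\<^sub>n\<close>, and an odd reflection
  exchanges two neighbours. Since \<open>\<rho>\<^sub>\<Sigma>\<close> is orthogonal to the odd simple root \<open>\<alpha>\<close>, the reflection replaces
  the shifted highest weight \<open>\<mu>\<close> by \<open>\<mu> + \<alpha>\<close> if \<open>(\<mu>|\<alpha>) = 0\<close> and leaves it unchanged otherwise; the diagram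
  changes in the first case only. With \<open>\<alpha> = \<epsilon>\<^sub>i - \<delta>\<^sub>j\<close>, this reads: if the current value of \<open>\<epsilon>\<^sub>i\<close> equals that of
  \<open>- \<delta>\<^sub>j\<close>, both are raised by one. As \<open>\<epsilon>\<^sub>i\<close> has met exactly \<open>\<delta>\<^sub>1, \<dots>, \<delta>\<^sub>j\<^sub>-\<^sub>1\<close> and \<open>\<delta>\<^sub>j\<close> exactly \<open>\<epsilon>\<^sub>m, \<dots>, \<epsilon>\<^sub>i\<^sub>+\<^sub>1\<close>, the
  outcome depends on \<open>i\<close> and \<open>j\<close> alone. The value of \<open>\<epsilon>\<^sub>i\<close> climbs from \<open>x i\<close> to the first integer that is free
  among the values of the \<open>- \<delta>\<^sub>j\<close>, which is the end of the arrow at \<open>i\<close>, and meets on its way the last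
  \<open>k\<^sub>i - x i\<close> of the \<open>M\<^sub>i\<close> values below \<open>k\<^sub>i\<close>.

  Highest weights of a simple module are unique because the descendants of a highest weight vector under
  lowering operators span a submodule; commuting a raising operator to the right shows this without the
  PBW theorem.
\<close>

section \<open>Bases and placements of the indices\<close>

interpretation wt: vector_space weight_scale
  by unfold_locales (auto simp: weight_scale_def fun_eq_iff algebra_simps)

section \<open>Roots as ordered pairs of signed indices\<close>

lemma finite_idx [simp]: "finite (idx m n)"
  by (simp add: idx_def)

lemma card_idx: "card (idx m n) = m + n"
  unfolding idx_def by (subst card_Un_disjoint) auto

text \<open>For distinct indices the entries 1 and -1 show where the root starts and ends;
  \<open>root_of a a\<close> is 0 for every \<open>a\<close>, hence the hypothesis.\<close>

lemma root_of_eq_iff: "a \<noteq> b \<Longrightarrow> root_of a b = root_of c d \<longleftrightarrow> a = c \<and> b = d"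
  by (auto simp: root_of_def fun_eq_iff split: if_splits)

lemma root_of_eq_0_iff: "root_of a b = 0 \<longleftrightarrow> a = b"
  by (auto simp: root_of_def fun_eq_iff)

lemma uminus_root_of: "- root_of a b = root_of b a"
  by (auto simp: root_of_def fun_eq_iff)

lemma root_of_add: "root_of a b + root_of b c = root_of a c"
  by (auto simp: root_of_def fun_eq_iff)

lemma eps_diff: "eps i - eps j = root_of i j"
  by (auto simp: root_of_def eps_def fun_eq_iff)

lemma delta_diff: "delta i - delta j = root_of (- i) (- j)"
  by (auto simp: root_of_def delta_def fun_eq_iff)

lemma eps_diff_delta: "eps i - delta j = root_of i (- j)"
  by (auto simp: root_of_def eps_def delta_def fun_eq_iff)

lemma right_odd_roots_eq:
  "right_odd_roots m n = {root_of a b | a b. a \<in> {1..int m} \<and> b \<in> {- int n..-1}}"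
  unfolding right_odd_roots_def eps_diff_delta
proof (intro set_eqI iffI)
  fix x assume "x \<in> {root_of a b | a b. a \<in> {1..int m} \<and> b \<in> {- int n..-1}}"
  then obtain a b where "x = root_of a (- (- b))" "a \<in> {1..int m}" "- b \<in> {1..int n}" by auto
  then show "x \<in> {root_of i (- j) |i j. i \<in> {1..int m} \<and> j \<in> {1..int n}}" by blast
qed force

text \<open>With signed indices the parity of \<open>root_of a b\<close> can be read off from the
  signs of \<open>a\<close> and \<open>b\<close>, so even and odd roots can be treated
  uniformly.\<close>

lemma odd_roots_eq:
  "odd_roots m n = {root_of a b | a b. a \<in> idx m n \<and> b \<in> idx m n \<and> (a < 0) \<noteq> (b < 0)}"
proof -
  have "uminus ` right_odd_roots m n = {root_of a b | a b. a \<in> {- int n..-1} \<and> b \<in> {1..int m}}"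
    unfolding right_odd_roots_eq
  proof (intro set_eqI iffI)
    fix x assume "x \<in> {root_of a b | a b. a \<in> {- int n..-1} \<and> b \<in> {1..int m}}"
    then obtain a b where "x = - root_of b a" "a \<in> {- int n..-1}" "b \<in> {1..int m}"
      by (auto simp: uminus_root_of)
    then show "x \<in> uminus ` {root_of a b | a b. a \<in> {1..int m} \<and> b \<in> {- int n..-1}}" by blast
  next
    fix x assume "x \<in> uminus ` {root_of a b | a b. a \<in> {1..int m} \<and> b \<in> {- int n..-1}}"
    then obtain a b where "x = root_of b a" "a \<in> {1..int m}" "b \<in> {- int n..-1}"
      by (auto simp: uminus_root_of)
    then show "x \<in> {root_of a b | a b. a \<in> {- int n..-1} \<and> b \<in> {1..int m}}" by blast
  qed
  moreover have "a \<in> idx m n \<and> b \<in> idx m n \<and> (a < 0) \<noteq> (b < 0) \<longleftrightarrow>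
      a \<in> {1..int m} \<and> b \<in> {- int n..-1} \<or> a \<in> {- int n..-1} \<and> b \<in> {1..int m}" for a b
    by (auto simp: idx_def)
  ultimately show ?thesis
    unfolding odd_roots_def by (simp only: right_odd_roots_eq) blast
qed

lemma even_roots_eq:
  "even_roots m n = {root_of a b | a b. a \<in> idx m n \<and> b \<in> idx m n \<and> a \<noteq> b \<and> (a < 0) = (b < 0)}"
proof -
  have "{delta i - delta j | i j. i \<in> {1..int n} \<and> j \<in> {1..int n} \<and> i \<noteq> j} =
      {root_of a b | a b. a \<in> {- int n..-1} \<and> b \<in> {- int n..-1} \<and> a \<noteq> b}"
    unfolding delta_diff
  proof (intro set_eqI iffI)
    fix x assume "x \<in> {root_of a b | a b. a \<in> {- int n..-1} \<and> b \<in> {- int n..-1} \<and> a \<noteq> b}"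
    then obtain a b where "x = root_of (- (- a)) (- (- b))" "- a \<in> {1..int n}" "- b \<in> {1..int n}" "- a \<noteq> - b"
      by auto
    then show "x \<in> {root_of (- i) (- j) | i j. i \<in> {1..int n} \<and> j \<in> {1..int n} \<and> i \<noteq> j}" by blast
  qed force
  moreover have "a \<in> idx m n \<and> b \<in> idx m n \<and> a \<noteq> b \<and> (a < 0) = (b < 0) \<longleftrightarrow>
      a \<in> {1..int m} \<and> b \<in> {1..int m} \<and> a \<noteq> b \<or>
      a \<in> {- int n..-1} \<and> b \<in> {- int n..-1} \<and> a \<noteq> b" for a b
    by (auto simp: idx_def)
  ultimately show ?thesis
    unfolding even_roots_def by (simp only: eps_diff) blast
qed

lemma roots_eq: "roots m n = {root_of a b | a b. a \<in> idx m n \<and> b \<in> idx m n \<and> a \<noteq> b}"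
  unfolding roots_def even_roots_eq odd_roots_eq by blast

lemma finite_roots: "finite (roots m n)"
proof -
  have "roots m n \<subseteq> (\<lambda>(a, b). root_of a b) ` (idx m n \<times> idx m n)" by (auto simp: roots_eq)
  then show ?thesis by (rule finite_subset) simp
qed

section \<open>Nonnegative integer combinations\<close>

lemma nonneg_comb_add:
  assumes "nonneg_comb \<Sigma> \<mu>" "nonneg_comb \<Sigma> \<nu>"
  shows "nonneg_comb \<Sigma> (\<mu> + \<nu>)"
proof -
  obtain c d :: "weight \<Rightarrow> int" where
    "\<forall>\<beta>\<in>\<Sigma>. c \<beta> \<ge> 0" "\<mu> = (\<Sum>\<beta>\<in>\<Sigma>. weight_scale (of_int (c \<beta>)) \<beta>)"
    "\<forall>\<beta>\<in>\<Sigma>. d \<beta> \<ge> 0" "\<nu> = (\<Sum>\<beta>\<in>\<Sigma>. weight_scale (of_int (d \<beta>)) \<beta>)"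
    using assms by (auto simp: nonneg_comb_def)
  then show ?thesis unfolding nonneg_comb_def
    by (intro exI[of _ "\<lambda>\<beta>. c \<beta> + d \<beta>"]) (simp add: wt.scale_left_distrib sum.distrib)
qed

lemma nonneg_comb_member:
  assumes "finite \<Sigma>" "\<alpha> \<in> \<Sigma>"
  shows "nonneg_comb \<Sigma> \<alpha>"
  unfolding nonneg_comb_def
proof (intro exI[of _ "\<lambda>\<beta>. of_bool (\<beta> = \<alpha>)"] conjI)
  have "(\<Sum>\<beta>\<in>\<Sigma>. weight_scale (of_int (of_bool (\<beta> = \<alpha>))) \<beta>) = (\<Sum>\<beta>\<in>\<Sigma>. if \<beta> = \<alpha> then \<alpha> else 0)"
    by (rule sum.cong) auto
  then show "\<alpha> = (\<Sum>\<beta>\<in>\<Sigma>. weight_scale (of_int (of_bool (\<beta> = \<alpha>))) \<beta>)" using assms by simp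
qed auto

lemma nonpos_comb_iff: "nonpos_comb \<Sigma> \<mu> \<longleftrightarrow> nonneg_comb \<Sigma> (- \<mu>)"
proof
  assume "nonpos_comb \<Sigma> \<mu>"
  then obtain c :: "weight \<Rightarrow> int" where
    "\<forall>\<beta>\<in>\<Sigma>. c \<beta> \<le> 0" "\<mu> = (\<Sum>\<beta>\<in>\<Sigma>. weight_scale (of_int (c \<beta>)) \<beta>)"
    by (auto simp: nonpos_comb_def)
  then show "nonneg_comb \<Sigma> (- \<mu>)" unfolding nonneg_comb_def
    by (intro exI[of _ "\<lambda>\<beta>. - c \<beta>"]) (simp add: sum_negf)
next
  assume "nonneg_comb \<Sigma> (- \<mu>)"
  then obtain c :: "weight \<Rightarrow> int" where
    c: "\<forall>\<beta>\<in>\<Sigma>. c \<beta> \<ge> 0" "- \<mu> = (\<Sum>\<beta>\<in>\<Sigma>. weight_scale (of_int (c \<beta>)) \<beta>)"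
    by (auto simp: nonneg_comb_def)
  then have "\<mu> = - (\<Sum>\<beta>\<in>\<Sigma>. weight_scale (of_int (c \<beta>)) \<beta>)" by (metis minus_minus)
  with c show "nonpos_comb \<Sigma> \<mu>" unfolding nonpos_comb_def
    by (intro exI[of _ "\<lambda>\<beta>. - c \<beta>"]) (simp add: sum_negf)
qed

text \<open>Adding the two expansions gives a linear relation with coefficients
  \<open>c \<beta> + d \<beta>\<close>. Independence makes these sums 0, and two nonnegative
  integers with sum 0 both vanish.\<close>

lemma nonneg_comb_antisym:
  assumes "finite \<Sigma>" "\<not> wt.dependent \<Sigma>" "nonneg_comb \<Sigma> \<mu>" "nonneg_comb \<Sigma> (- \<mu>)"
  shows "\<mu> = 0"
proof -
  obtain c d :: "weight \<Rightarrow> int" where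
    c: "\<forall>\<beta>\<in>\<Sigma>. c \<beta> \<ge> 0" "\<mu> = (\<Sum>\<beta>\<in>\<Sigma>. weight_scale (of_int (c \<beta>)) \<beta>)" and
    d: "\<forall>\<beta>\<in>\<Sigma>. d \<beta> \<ge> 0" "- \<mu> = (\<Sum>\<beta>\<in>\<Sigma>. weight_scale (of_int (d \<beta>)) \<beta>)"
    using assms by (auto simp: nonneg_comb_def)
  have "\<mu> + - \<mu> = (\<Sum>\<beta>\<in>\<Sigma>. weight_scale (of_int (c \<beta> + d \<beta>)) \<beta>)"
    unfolding d(2) by (subst c(2)) (simp add: wt.scale_left_distrib sum.distrib)
  then have "(\<Sum>\<beta>\<in>\<Sigma>. weight_scale (of_int (c \<beta> + d \<beta>)) \<beta>) = 0" by simp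
  then have "c \<beta> + d \<beta> = 0" if "\<beta> \<in> \<Sigma>" for \<beta>
    using wt.independentD[OF assms(2,1) subset_refl _ that, of "\<lambda>\<beta>. of_int (c \<beta> + d \<beta>)"]
    by (simp only: of_int_eq_0_iff)
  then have "c \<beta> = 0" if "\<beta> \<in> \<Sigma>" for \<beta> using c(1) d(1) that by force
  then show ?thesis using c(2) by simp
qed

text \<open>By independence the coefficients of \<mu> and \<nu> add up to 1 at the simple root
  \<open>\<mu> + \<nu>\<close> and to 0 at every other one. Being nonnegative integers, those of one
  summand are all 0.\<close>

lemma simple_indecomposable:
  assumes "finite \<Sigma>" "\<not> wt.dependent \<Sigma>" "nonneg_comb \<Sigma> \<mu>" "nonneg_comb \<Sigma> \<nu>" "\<mu> + \<nu> \<in> \<Sigma>"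
  shows "\<mu> = 0 \<or> \<nu> = 0"
proof -
  obtain c d :: "weight \<Rightarrow> int" where
    c: "\<forall>\<beta>\<in>\<Sigma>. c \<beta> \<ge> 0" "\<mu> = (\<Sum>\<beta>\<in>\<Sigma>. weight_scale (of_int (c \<beta>)) \<beta>)" and
    d: "\<forall>\<beta>\<in>\<Sigma>. d \<beta> \<ge> 0" "\<nu> = (\<Sum>\<beta>\<in>\<Sigma>. weight_scale (of_int (d \<beta>)) \<beta>)"
    using assms by (auto simp: nonneg_comb_def)
  define e where "e \<beta> = c \<beta> + d \<beta> - of_bool (\<beta> = \<mu> + \<nu>)" for \<beta>
  have "(\<Sum>\<beta>\<in>\<Sigma>. weight_scale (of_int (of_bool (\<beta> = \<mu> + \<nu>))) \<beta>) = (\<Sum>\<beta>\<in>\<Sigma>. if \<beta> = \<mu> + \<nu> then \<mu> + \<nu> else 0)"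
    by (rule sum.cong) auto
  also have "\<dots> = \<mu> + \<nu>" using assms by simp
  finally have "(\<Sum>\<beta>\<in>\<Sigma>. weight_scale (of_int (e \<beta>)) \<beta>) = \<mu> + \<nu> - (\<mu> + \<nu>)"
    by (simp only: e_def of_int_add of_int_diff wt.scale_left_distrib wt.scale_left_diff_distrib
        sum.distrib sum_subtractf c(2)[symmetric] d(2)[symmetric])
  then have "(\<Sum>\<beta>\<in>\<Sigma>. weight_scale (of_int (e \<beta>)) \<beta>) = 0" by simp
  then have e: "e \<beta> = 0" if "\<beta> \<in> \<Sigma>" for \<beta>
    using wt.independentD[OF assms(2,1) subset_refl _ that, of "\<lambda>\<beta>. of_int (e \<beta>)"]
    by (simp only: of_int_eq_0_iff)
  have other: "c \<beta> = 0 \<and> d \<beta> = 0" if "\<beta> \<in> \<Sigma>" "\<beta> \<noteq> \<mu> + \<nu>" for \<beta>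
  proof -
    have "c \<beta> \<ge> 0" "d \<beta> \<ge> 0" using c(1) d(1) that by auto
    then show ?thesis using e[OF that(1)] that(2) by (simp add: e_def)
  qed
  have "c (\<mu> + \<nu>) \<ge> 0" "d (\<mu> + \<nu>) \<ge> 0" using c(1) d(1) assms(5) by auto
  moreover have "c (\<mu> + \<nu>) + d (\<mu> + \<nu>) = 1" using e[OF assms(5)] by (simp add: e_def)
  ultimately have "c (\<mu> + \<nu>) = 0 \<or> d (\<mu> + \<nu>) = 0" by linarith
  then have "(\<forall>\<beta>\<in>\<Sigma>. c \<beta> = 0) \<or> (\<forall>\<beta>\<in>\<Sigma>. d \<beta> = 0)" using other by metis
  then show ?thesis using c(2) d(2) by auto
qed

text \<open>
  A base is encoded by the order in which it lists the indices: \<open>p a\<close> is the place of the index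
  \<open>a\<close>, counted from \<open>0\<close>.
\<close>

definition placement :: "nat \<Rightarrow> nat \<Rightarrow> (int \<Rightarrow> int) \<Rightarrow> bool" where
  "placement m n p \<longleftrightarrow> bij_betw p (idx m n) {0..<int (m + n)}"

text \<open>Increasing places within each of the two families are what the prescribed positive even
  roots of \<open>std_bases\<close> amount to.\<close>

definition shuffle :: "nat \<Rightarrow> nat \<Rightarrow> (int \<Rightarrow> int) \<Rightarrow> bool" where
  "shuffle m n p \<longleftrightarrow> placement m n p \<and> strict_mono_on {1..int m} p \<and>
     strict_mono_on {1..int n} (\<lambda>j. p (- j))"

definition positive_roots :: "nat \<Rightarrow> nat \<Rightarrow> (int \<Rightarrow> int) \<Rightarrow> weight set" where
  "positive_roots m n p = {root_of a b | a b. a \<in> idx m n \<and> b \<in> idx m n \<and> p a < p b}"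

definition adjacent_roots :: "nat \<Rightarrow> nat \<Rightarrow> (int \<Rightarrow> int) \<Rightarrow> weight set" where
  "adjacent_roots m n p = {root_of a b | a b. a \<in> idx m n \<and> b \<in> idx m n \<and> p b = p a + 1}"

section \<open>Placements and the roots they make positive\<close>

lemma placement_inj: "placement m n p \<Longrightarrow> inj_on p (idx m n)"
  by (simp add: placement_def bij_betw_def)

lemma placement_eq_iff:
  "placement m n p \<Longrightarrow> a \<in> idx m n \<Longrightarrow> b \<in> idx m n \<Longrightarrow> p a = p b \<longleftrightarrow> a = b"
  using placement_inj inj_on_eq_iff by metis

lemma placement_range: "placement m n p \<Longrightarrow> a \<in> idx m n \<Longrightarrow> 0 \<le> p a \<and> p a < int (m + n)"
  unfolding placement_def bij_betw_def by (metis atLeastLessThan_iff imageI)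

lemma placement_surj:
  assumes "placement m n p" "0 \<le> k" "k < int (m + n)"
  obtains c where "c \<in> idx m n" "p c = k"
  using assms unfolding placement_def bij_betw_def by (metis atLeastLessThan_iff imageE)

text \<open>An injection into a set of the same finite cardinality \<open>m + n\<close> is
  onto.\<close>

lemma placementI:
  assumes "inj_on p (idx m n)" "\<And>a. a \<in> idx m n \<Longrightarrow> 0 \<le> p a \<and> p a < int (m + n)"
  shows "placement m n p"
proof -
  have "p ` idx m n \<subseteq> {0..<int (m + n)}" using assms(2) by auto
  moreover have "card (p ` idx m n) = card {0..<int (m + n)}"
    using assms(1) by (simp add: card_image card_idx)
  ultimately have "p ` idx m n = {0..<int (m + n)}" by (intro card_subset_eq) auto
  then show ?thesis using assms(1) by (simp add: placement_def bij_betw_def)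
qed

lemma root_of_in_positive_roots:
  "root_of a b \<in> positive_roots m n p \<longleftrightarrow> a \<in> idx m n \<and> b \<in> idx m n \<and> p a < p b" (is "?L \<longleftrightarrow> ?R")
proof
  assume ?L
  then obtain c d where "root_of c d = root_of a b" "c \<in> idx m n" "d \<in> idx m n" "p c < p d"
    by (auto simp: positive_roots_def)
  moreover from this have "c \<noteq> d" by auto
  ultimately show ?R by (auto simp: root_of_eq_iff)
qed (auto simp: positive_roots_def)

lemma root_of_in_adjacent_roots:
  "root_of a b \<in> adjacent_roots m n p \<longleftrightarrow> a \<in> idx m n \<and> b \<in> idx m n \<and> p b = p a + 1" (is "?L \<longleftrightarrow> ?R")
proof
  assume ?L
  then obtain c d where "root_of c d = root_of a b" "c \<in> idx m n" "d \<in> idx m n" "p d = p c + 1"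
    by (auto simp: adjacent_roots_def)
  moreover from this have "c \<noteq> d" by auto
  ultimately show ?R by (auto simp: root_of_eq_iff)
qed (auto simp: adjacent_roots_def)

lemma adjacent_roots_subset_roots: "adjacent_roots m n p \<subseteq> roots m n"
  by (auto simp: adjacent_roots_def roots_eq) (metis less_add_one less_irrefl)

lemma finite_adjacent_roots: "finite (adjacent_roots m n p)"
  using adjacent_roots_subset_roots finite_roots by (rule finite_subset)

text \<open>A linear functional whose value at \<open>root_of a b\<close> is the distance
  \<open>p b - p a\<close>, hence positive on the positive roots. It also serves to separate weights
  of a module.\<close>

definition height :: "nat \<Rightarrow> nat \<Rightarrow> (int \<Rightarrow> int) \<Rightarrow> weight \<Rightarrow> complex" where
  "height m n p \<mu> = (\<Sum>c\<in>idx m n. of_int (- p c) * \<mu> c)"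

lemma height_root_of:
  assumes "a \<in> idx m n" "b \<in> idx m n"
  shows "height m n p (root_of a b) = of_int (p b - p a)"
proof -
  have "height m n p (root_of a b) =
      (\<Sum>c\<in>idx m n. (if c = a then - of_int (p a) else 0) - (if c = b then - of_int (p b) else 0))"
    unfolding height_def by (rule sum.cong) (auto simp: root_of_def)
  then show ?thesis using assms by (simp add: sum_subtractf)
qed

lemma height_add: "height m n p (\<mu> + \<nu>) = height m n p \<mu> + height m n p \<nu>"
  unfolding height_def sum.distrib[symmetric] by (rule sum.cong) (simp_all add: distrib_left)

lemma linear_combination_apply:
  fixes f :: "weight \<Rightarrow> complex"
  assumes "\<And>\<mu> \<nu>. f (\<mu> + \<nu>) = f \<mu> + f \<nu>" "\<And>c \<mu>. f (weight_scale c \<mu>) = c * f \<mu>"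
  shows "f (\<Sum>\<beta>\<in>S. weight_scale (u \<beta>) \<beta>) = (\<Sum>\<beta>\<in>S. u \<beta> * f \<beta>)"
proof -
  have "f 0 = 0" using assms(2)[of 0 0] by simp
  then show ?thesis by (induction S rule: infinite_finite_induct) (auto simp: assms)
qed

lemma height_scale: "height m n p (weight_scale c \<mu>) = c * height m n p \<mu>"
  by (simp add: height_def weight_scale_def sum_distrib_left mult_ac)

text \<open>The height is nonnegative on nonnegative combinations of \<Sigma>, so a root of this
  kind cannot point backwards, and injectivity excludes height 0.\<close>

lemma pos_roots_eqI:
  assumes sub: "\<Sigma> \<subseteq> positive_roots m n p" and inj: "inj_on p (idx m n)"
    and comb: "\<And>\<gamma>. \<gamma> \<in> positive_roots m n p \<Longrightarrow> nonneg_comb \<Sigma> \<gamma>"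
  shows "pos_roots m n \<Sigma> = positive_roots m n p"
proof
  show "positive_roots m n p \<subseteq> pos_roots m n \<Sigma>"
    using comb by (auto simp: pos_roots_def positive_roots_def roots_eq)
next
  show "pos_roots m n \<Sigma> \<subseteq> positive_roots m n p"
  proof
    fix \<gamma> assume "\<gamma> \<in> pos_roots m n \<Sigma>"
    then obtain a b c where ab: "\<gamma> = root_of a b" "a \<in> idx m n" "b \<in> idx m n" "a \<noteq> b"
      and c: "\<forall>\<beta>\<in>\<Sigma>. c \<beta> \<ge> (0::int)" "\<gamma> = (\<Sum>\<beta>\<in>\<Sigma>. weight_scale (of_int (c \<beta>)) \<beta>)"
      by (auto simp: pos_roots_def roots_eq nonneg_comb_def)
    have "height m n p \<gamma> = (\<Sum>\<beta>\<in>\<Sigma>. of_int (c \<beta>) * height m n p \<beta>)"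
      unfolding c(2) by (rule linear_combination_apply) (auto simp: height_add height_scale)
    \<comment> \<open>Heights are complex numbers, so they are compared through their real
      parts.\<close>
    then have "Re (height m n p \<gamma>) = (\<Sum>\<beta>\<in>\<Sigma>. Re (of_int (c \<beta>) * height m n p \<beta>))" by simp
    also have "\<dots> \<ge> 0"
    proof (rule sum_nonneg)
      fix \<beta> assume \<beta>: "\<beta> \<in> \<Sigma>"
      then obtain x y where "\<beta> = root_of x y" "x \<in> idx m n" "y \<in> idx m n" "p x < p y"
        using sub by (auto simp: positive_roots_def)
      then show "0 \<le> Re (of_int (c \<beta>) * height m n p \<beta>)"
        using c(1) \<beta> by (simp add: height_root_of)
    qed
    finally have "p a \<le> p b" using ab by (simp add: height_root_of)
    moreover have "p a \<noteq> p b" using ab inj by (auto dest: inj_onD)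
    ultimately have "p a < p b" by simp
    then show "\<gamma> \<in> positive_roots m n p" using ab unfolding positive_roots_def by blast
  qed
qed

text \<open>The root telescopes into the adjacent roots that lead from place \<open>p a\<close> to
  place \<open>p b\<close>; every place in between is taken because \<open>p\<close> is
  onto.\<close>

lemma nonneg_comb_adjacent_roots:
  assumes p: "placement m n p" and ab: "a \<in> idx m n" "b \<in> idx m n" "p a < p b"
  shows "nonneg_comb (adjacent_roots m n p) (root_of a b)"
proof -
  have "b \<in> idx m n \<Longrightarrow> p b = k \<Longrightarrow> nonneg_comb (adjacent_roots m n p) (root_of a b)"
    if "p a + 1 \<le> k" for k b
    using that
  proof (induction k arbitrary: b rule: int_ge_induct)
    case base
    then show ?case using ab
      by (intro nonneg_comb_member finite_adjacent_roots) (simp add: root_of_in_adjacent_roots)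
  next
    case (step k)
    have "0 \<le> k" "k < int (m + n)"
      using placement_range[OF p ab(1)] placement_range[OF p step(3)] step by auto
    then obtain c where c: "c \<in> idx m n" "p c = k" using placement_surj[OF p] by metis
    have "nonneg_comb (adjacent_roots m n p) (root_of c b)"
      using step c by (intro nonneg_comb_member finite_adjacent_roots) (simp add: root_of_in_adjacent_roots)
    with step.IH[OF c] show ?case using nonneg_comb_add root_of_add by metis
  qed
  from this[of "p b" b] show ?thesis using ab by simp
qed

lemma pos_roots_adjacent_roots:
  assumes "placement m n p"
  shows "pos_roots m n (adjacent_roots m n p) = positive_roots m n p"
proof (rule pos_roots_eqI)
  show "adjacent_roots m n p \<subseteq> positive_roots m n p"
    by (auto simp: adjacent_roots_def positive_roots_def) (metis less_add_one)
  show "nonneg_comb (adjacent_roots m n p) \<gamma>" if "\<gamma> \<in> positive_roots m n p" for \<gamma>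
    using that nonneg_comb_adjacent_roots[OF assms] by (auto simp: positive_roots_def)
qed (rule placement_inj[OF assms])

text \<open>These functionals are dual to the adjacent roots: the one at \<open>k\<close> is 1 on
  the adjacent root that leads from place \<open>k\<close> to \<open>k + 1\<close> and 0 on the
  other ones.\<close>

definition prefix_sum :: "nat \<Rightarrow> nat \<Rightarrow> (int \<Rightarrow> int) \<Rightarrow> int \<Rightarrow> weight \<Rightarrow> complex" where
  "prefix_sum m n p k \<mu> = (\<Sum>c\<in>{c \<in> idx m n. p c \<le> k}. \<mu> c)"

lemma prefix_sum_add: "prefix_sum m n p k (\<mu> + \<nu>) = prefix_sum m n p k \<mu> + prefix_sum m n p k \<nu>"
  by (simp add: prefix_sum_def sum.distrib)

lemma prefix_sum_scale: "prefix_sum m n p k (weight_scale c \<mu>) = c * prefix_sum m n p k \<mu>"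
  by (simp add: prefix_sum_def weight_scale_def sum_distrib_left)

lemma prefix_sum_adjacent:
  assumes "a \<in> idx m n" "b \<in> idx m n" "p b = p a + 1"
  shows "prefix_sum m n p k (root_of a b) = of_bool (p a = k)"
proof -
  have "prefix_sum m n p k (root_of a b) = of_bool (p a \<le> k) - of_bool (p b \<le> k)"
    using assms by (simp add: prefix_sum_def root_of_def sum_subtractf)
  then show ?thesis using assms by auto
qed

text \<open>The dual functional at the place where \<alpha> starts isolates the coefficient of
  \<alpha> in a linear relation.\<close>

lemma independent_adjacent_roots:
  assumes p: "placement m n p"
  shows "\<not> wt.dependent (adjacent_roots m n p)"
proof
  assume "wt.dependent (adjacent_roots m n p)"
  then obtain S u \<alpha> where S: "finite S" "S \<subseteq> adjacent_roots m n p"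
    and u: "(\<Sum>\<beta>\<in>S. weight_scale (u \<beta>) \<beta>) = 0" "\<alpha> \<in> S" "u \<alpha> \<noteq> 0"
    by (auto simp: wt.dependent_explicit)
  obtain a b where ab: "\<alpha> = root_of a b" "a \<in> idx m n" "b \<in> idx m n" "p b = p a + 1"
    using S u by (auto simp: adjacent_roots_def)
  have "prefix_sum m n p (p a) (\<Sum>\<beta>\<in>S. weight_scale (u \<beta>) \<beta>) = (\<Sum>\<beta>\<in>S. u \<beta> * prefix_sum m n p (p a) \<beta>)"
    by (rule linear_combination_apply) (auto simp: prefix_sum_add prefix_sum_scale)
  also have "\<dots> = (\<Sum>\<beta>\<in>S. if \<beta> = \<alpha> then u \<alpha> else 0)"
  proof (rule sum.cong)
    fix \<beta> assume "\<beta> \<in> S"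
    then obtain c d where cd: "\<beta> = root_of c d" "c \<in> idx m n" "d \<in> idx m n" "p d = p c + 1"
      using S by (auto simp: adjacent_roots_def)
    have "p c = p a \<longleftrightarrow> \<beta> = \<alpha>"
      using ab cd placement_eq_iff[OF p] by (metis root_of_in_adjacent_roots root_of_eq_iff less_add_one less_irrefl)
    then show "u \<beta> * prefix_sum m n p (p a) \<beta> = (if \<beta> = \<alpha> then u \<alpha> else 0)"
      using prefix_sum_adjacent[OF cd(2-4)] cd(1) by auto
  qed simp
  also have "\<dots> = u \<alpha>" using S u by simp
  finally show False using u by (simp add: prefix_sum_def)
qed

section \<open>Correspondence between bases and placements\<close>

lemma is_base_adjacent_roots:
  assumes p: "placement m n p"
  shows "is_base m n (adjacent_roots m n p)"
proof -
  have "nonneg_comb (adjacent_roots m n p) \<alpha> \<or> nonpos_comb (adjacent_roots m n p) \<alpha>"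
    if \<alpha>: "\<alpha> \<in> roots m n" for \<alpha>
  proof -
    obtain a b where ab: "\<alpha> = root_of a b" "a \<in> idx m n" "b \<in> idx m n" "a \<noteq> b"
      using \<alpha> by (auto simp: roots_eq)
    then have "p a < p b \<or> p b < p a" using placement_eq_iff[OF p] by (metis linorder_neqE)
    then show ?thesis
      using ab nonneg_comb_adjacent_roots[OF p] by (auto simp: nonpos_comb_iff uminus_root_of)
  qed
  then show ?thesis
    using adjacent_roots_subset_roots independent_adjacent_roots[OF p] by (simp add: is_base_def)
qed

text \<open>A base orders the indices totally: \<open>a\<close> precedes \<open>b\<close> if
  \<open>root_of a b\<close> is a nonnegative combination. Antisymmetry comes from independence,
  transitivity from adding combinations, totality from the sign condition on roots.\<close>

lemma base_placement:
  assumes base: "is_base m n \<Sigma>"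
  obtains p where "placement m n p" "\<Sigma> = adjacent_roots m n p"
proof -
  have sub: "\<Sigma> \<subseteq> roots m n" and ind: "\<not> wt.dependent \<Sigma>" using base by (auto simp: is_base_def)
  have fin: "finite \<Sigma>" using sub finite_roots by (rule finite_subset)
  define N where "N a b \<longleftrightarrow> nonneg_comb \<Sigma> (root_of a b)" for a b
  have asym: "a = b" if "N a b" "N b a" for a b
    using nonneg_comb_antisym[OF fin ind, of "root_of a b"] that
    by (simp add: N_def uminus_root_of root_of_eq_0_iff)
  have trans: "N a c" if "N a b" "N b c" for a b c
    using nonneg_comb_add[of \<Sigma> "root_of a b" "root_of b c"] that by (simp add: N_def root_of_add)
  have total: "N a b \<or> N b a" if "a \<in> idx m n" "b \<in> idx m n" "a \<noteq> b" for a b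
  proof -
    have "root_of a b \<in> roots m n" using that by (auto simp: roots_eq)
    then show ?thesis using base by (auto simp: is_base_def nonpos_comb_iff N_def uminus_root_of)
  qed
  \<comment> \<open>The number of strict predecessors of \<open>c\<close>, so that places start at
    0.\<close>
  define p where "p c = int (card {d \<in> idx m n. d \<noteq> c \<and> N d c})" for c
  have mono: "p a < p b" if "N a b" "a \<noteq> b" "a \<in> idx m n" for a b
  proof -
    have "{d \<in> idx m n. d \<noteq> a \<and> N d a} \<subset> {d \<in> idx m n. d \<noteq> b \<and> N d b}"
    proof
      show "{d \<in> idx m n. d \<noteq> a \<and> N d a} \<subseteq> {d \<in> idx m n. d \<noteq> b \<and> N d b}"
        using that trans asym by blast
      show "{d \<in> idx m n. d \<noteq> a \<and> N d a} \<noteq> {d \<in> idx m n. d \<noteq> b \<and> N d b}"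
        using that by blast
    qed
    then have "card {d \<in> idx m n. d \<noteq> a \<and> N d a} < card {d \<in> idx m n. d \<noteq> b \<and> N d b}"
      by (rule psubset_card_mono[rotated]) simp
    then show ?thesis by (simp add: p_def)
  qed
  have N: "N a b" if "p a < p b" "a \<in> idx m n" "b \<in> idx m n" for a b
    using total[OF that(2,3)] mono[of b a] that by force
  have p: "placement m n p"
  proof (rule placementI)
    show "inj_on p (idx m n)" using total mono by (metis inj_onI less_irrefl)
    show "0 \<le> p a \<and> p a < int (m + n)" if "a \<in> idx m n" for a
    proof -
      have "card {d \<in> idx m n. d \<noteq> a \<and> N d a} < card (idx m n)"
        using that by (intro psubset_card_mono) auto
      then show ?thesis by (simp add: p_def card_idx)
    qed
  qed
  have adj: "\<Sigma> \<subseteq> adjacent_roots m n p"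
  proof
    fix \<beta> assume \<beta>: "\<beta> \<in> \<Sigma>"
    then obtain a b where ab: "\<beta> = root_of a b" "a \<in> idx m n" "b \<in> idx m n" "a \<noteq> b"
      using sub by (auto simp: roots_eq)
    have "N a b" using nonneg_comb_member[OF fin \<beta>] ab by (simp add: N_def)
    then have less: "p a < p b" using mono ab by blast
    \<comment> \<open>An index strictly between \<open>a\<close> and \<open>b\<close> would split
      the simple root into two nonzero nonnegative combinations.\<close>
    have "p b = p a + 1"
    proof (rule ccontr)
      assume ne: "p b \<noteq> p a + 1"
      obtain c where c: "c \<in> idx m n" "p c = p a + 1"
        using placement_surj[OF p, of "p a + 1"] placement_range[OF p ab(2)] placement_range[OF p ab(3)] less ne
        by (metis add_increasing2 add_strict_increasing2 zero_le_one zless_imp_add1_zle le_less_trans)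
      then have "N a c" "N c b" using N ab less ne by auto
      then have "root_of a c = 0 \<or> root_of c b = 0"
        using simple_indecomposable[OF fin ind, of "root_of a c" "root_of c b"] \<beta> ab
        by (simp add: N_def root_of_add)
      then show False using c ne by (auto simp: root_of_eq_0_iff)
    qed
    then show "\<beta> \<in> adjacent_roots m n p" using ab by (auto simp: adjacent_roots_def)
  qed
  moreover have "adjacent_roots m n p \<subseteq> \<Sigma>"
  proof
    fix \<alpha> assume "\<alpha> \<in> adjacent_roots m n p"
    then obtain a b where ab: "\<alpha> = root_of a b" "a \<in> idx m n" "b \<in> idx m n" "p b = p a + 1"
      by (auto simp: adjacent_roots_def)
    then have "nonneg_comb \<Sigma> \<alpha>" using N[of a b] by (simp add: N_def)
    then obtain c :: "weight \<Rightarrow> int" where "\<alpha> = (\<Sum>\<beta>\<in>\<Sigma>. weight_scale (of_int (c \<beta>)) \<beta>)"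
      by (auto simp: nonneg_comb_def)
    then have "prefix_sum m n p (p a) \<alpha> = (\<Sum>\<beta>\<in>\<Sigma>. of_int (c \<beta>) * prefix_sum m n p (p a) \<beta>)"
      by (simp only:) (rule linear_combination_apply, auto simp: prefix_sum_add prefix_sum_scale)
    moreover have "prefix_sum m n p (p a) \<alpha> = 1" using prefix_sum_adjacent[OF ab(2-4)] ab by simp
    \<comment> \<open>The functional dual to \<alpha> is 1 on \<alpha>, so it cannot vanish on all
      simple roots; the simple root found here is adjacent and leads across the same places, hence
      equals \<alpha>.\<close>
    ultimately obtain \<beta> where \<beta>: "\<beta> \<in> \<Sigma>" "prefix_sum m n p (p a) \<beta> \<noteq> 0"
      by (metis (no_types, lifting) mult_zero_right sum.neutral zero_neq_one)
    obtain x y where xy: "\<beta> = root_of x y" "x \<in> idx m n" "y \<in> idx m n" "p y = p x + 1"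
      using adj \<beta> by (auto simp: adjacent_roots_def)
    have "p x = p a" using \<beta>(2) prefix_sum_adjacent[OF xy(2-4)] xy(1) by (auto split: if_splits)
    then have "p y = p b" using ab xy by simp
    with \<open>p x = p a\<close> have "x = a" "y = b"
      using placement_eq_iff[OF p xy(2) ab(2)] placement_eq_iff[OF p xy(3) ab(3)] by auto
    then show "\<alpha> \<in> \<Sigma>" using \<beta> ab xy by simp
  qed
  ultimately show thesis using that p by blast
qed

section \<open>Standard bases as shuffles\<close>

lemma positive_even_roots:
  assumes "inj_on p (idx m n)"
  shows "(positive_roots m n p \<inter> even_roots m n =
      {eps i - eps j | i j. 1 \<le> i \<and> i < j \<and> j \<le> int m} \<union>
      {delta i - delta j | i j. 1 \<le> i \<and> i < j \<and> j \<le> int n}) \<longleftrightarrow>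
    strict_mono_on {1..int m} p \<and> strict_mono_on {1..int n} (\<lambda>j. p (- j))" (is "?A = ?B \<longleftrightarrow> ?R")
proof
  assume eq: "?A = ?B"
  show ?R
  proof (intro conjI strict_mono_onI)
    fix i j assume "i \<in> {1..int m}" "j \<in> {1..int m}" "i < j"
    then have "root_of i j \<in> ?B" unfolding eps_diff by auto
    then have "root_of i j \<in> positive_roots m n p" unfolding eq[symmetric] by simp
    then show "p i < p j" by (simp add: root_of_in_positive_roots)
  next
    fix i j assume "i \<in> {1..int n}" "j \<in> {1..int n}" "i < j"
    then have "root_of (- i) (- j) \<in> ?B" unfolding delta_diff by auto
    then have "root_of (- i) (- j) \<in> positive_roots m n p" unfolding eq[symmetric] by simp
    then show "p (- i) < p (- j)" by (simp add: root_of_in_positive_roots)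
  qed
next
  assume R: ?R
  have eps_less: "p i < p j \<longleftrightarrow> i < j" if "i \<in> {1..int m}" "j \<in> {1..int m}" for i j
    using conjunct1[OF R] that by (simp add: strict_mono_on_less[of _ p])
  have delta_less: "p (- i) < p (- j) \<longleftrightarrow> i < j" if "i \<in> {1..int n}" "j \<in> {1..int n}" for i j
    using conjunct2[OF R] that by (simp add: strict_mono_on_less[of _ "\<lambda>j. p (- j)"])
  show "?A = ?B"
  proof
    show "?B \<subseteq> ?A"
      unfolding eps_diff delta_diff even_roots_eq
      by (auto simp: root_of_in_positive_roots idx_def eps_less delta_less) force+
    show "?A \<subseteq> ?B"
    proof
      fix \<gamma> assume "\<gamma> \<in> ?A"
      then obtain a b where \<gamma>: "\<gamma> = root_of a b" and ab: "a \<in> idx m n" "b \<in> idx m n" "(a < 0) = (b < 0)"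
        and less: "p a < p b"
        by (auto simp: even_roots_eq root_of_in_positive_roots)
      show "\<gamma> \<in> ?B"
      proof (cases "a < 0")
        case True
        then have "- a \<in> {1..int n}" "- b \<in> {1..int n}" using ab by (auto simp: idx_def)
        moreover from this have "- a < - b" using delta_less[of "- a" "- b"] less by simp
        moreover have "\<gamma> = delta (- a) - delta (- b)" by (simp add: \<gamma> delta_diff)
        moreover have "1 \<le> - a" "- b \<le> int n" using ab True by (auto simp: idx_def)
        ultimately show ?thesis by blast
      next
        case False
        then have "a \<in> {1..int m}" "b \<in> {1..int m}" using ab by (auto simp: idx_def)
        moreover from this have "a < b" using eps_less less by simp
        moreover have "\<gamma> = eps a - eps b" by (simp add: \<gamma> eps_diff)
        moreover have "1 \<le> a" "b \<le> int m" using ab False by (auto simp: idx_def)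
        ultimately show ?thesis by blast
      qed
    qed
  qed
qed

text \<open>Even roots compare two indices of the same sign. Prescribing the positive ones therefore
  fixes the order within each family and leaves only the interleaving of the two families
  free.\<close>

lemma std_bases_iff: "\<Sigma> \<in> std_bases m n \<longleftrightarrow> (\<exists>p. shuffle m n p \<and> \<Sigma> = adjacent_roots m n p)"
proof
  assume \<Sigma>: "\<Sigma> \<in> std_bases m n"
  then obtain p where p: "placement m n p" "\<Sigma> = adjacent_roots m n p"
    using base_placement[of m n \<Sigma>] unfolding std_bases_def by blast
  then have "shuffle m n p"
    using \<Sigma> positive_even_roots[OF placement_inj[OF p(1)]] pos_roots_adjacent_roots[OF p(1)]
    by (auto simp: std_bases_def shuffle_def)
  then show "\<exists>p. shuffle m n p \<and> \<Sigma> = adjacent_roots m n p" using p by blast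
next
  assume "\<exists>p. shuffle m n p \<and> \<Sigma> = adjacent_roots m n p"
  then obtain p where p: "shuffle m n p" "\<Sigma> = adjacent_roots m n p" by blast
  then have pl: "placement m n p" by (simp add: shuffle_def)
  show "\<Sigma> \<in> std_bases m n"
    using p positive_even_roots[OF placement_inj[OF pl]] pos_roots_adjacent_roots[OF pl]
      is_base_adjacent_roots[OF pl]
    by (auto simp: std_bases_def shuffle_def)
qed

section \<open>Odd reflections as swaps of neighbours\<close>

lemma form_odd_root:
  assumes "a \<in> {1..int m}" "b \<in> {- int n..-1}"
  shows "form m n \<mu> (root_of a b) = \<mu> a + \<mu> b"
proof -
  have "(\<Sum>i\<in>{1..int m}. \<mu> i * root_of a b i) = (\<Sum>i\<in>{1..int m}. if i = a then \<mu> a else 0)"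
    using assms by (intro sum.cong) (auto simp: root_of_def)
  moreover have "(\<Sum>j\<in>{1..int n}. \<mu> (- j) * root_of a b (- j)) = (\<Sum>j\<in>{1..int n}. if j = - b then - \<mu> b else 0)"
    using assms by (intro sum.cong) (auto simp: root_of_def)
  ultimately show ?thesis using assms by (simp add: form_def)
qed

lemma placement_swap:
  assumes p: "placement m n p" and ab: "a \<in> idx m n" "b \<in> idx m n"
  shows "placement m n (p(a := p b, b := p a))"
proof (rule placementI)
  show "inj_on (p(a := p b, b := p a)) (idx m n)"
    using ab placement_eq_iff[OF p] by (auto simp: inj_on_def)
  show "0 \<le> (p(a := p b, b := p a)) c \<and> (p(a := p b, b := p a)) c < int (m + n)" if "c \<in> idx m n" for c
    using placement_range[OF p] ab that by auto
qed

text \<open>Besides \<open>root_of a b\<close> itself, only the adjacent root ending at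
  \<open>a\<close> and the one starting at \<open>b\<close> fail to be orthogonal to it. Adding
  \<open>root_of a b\<close> moves the end of the former to \<open>b\<close> and the start of the
  latter to \<open>a\<close>, as the swap demands.\<close>

lemma odd_reflection_adjacent_roots:
  assumes p: "placement m n p" and a: "a \<in> {1..int m}" and b: "b \<in> {- int n..-1}"
    and adj: "p b = p a + 1"
  shows "odd_reflection m n (root_of a b) (adjacent_roots m n p) =
    adjacent_roots m n (p(a := p b, b := p a))"
proof -
  let ?p' = "p(a := p b, b := p a)"
  have ab: "a \<in> idx m n" "b \<in> idx m n" "a \<noteq> b" using a b by (auto simp: idx_def)
  have form: "form m n (root_of c d) (root_of a b) =
      of_bool (c = a) - of_bool (d = a) + (of_bool (c = b) - of_bool (d = b))" for c d
    unfolding form_odd_root[OF a b] by (auto simp: root_of_def)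
  note eq = placement_eq_iff[OF p]
  have one: "root_of c d \<in> adjacent_roots m n p \<longleftrightarrow> c \<in> idx m n \<and> d \<in> idx m n \<and> p d = p c + 1" for c d
    by (rule root_of_in_adjacent_roots)
  have two: "root_of c d \<in> adjacent_roots m n ?p' \<longleftrightarrow> c \<in> idx m n \<and> d \<in> idx m n \<and> ?p' d = ?p' c + 1" for c d
    by (rule root_of_in_adjacent_roots)
  have root_ne: "root_of c d \<noteq> root_of a b" if "c \<noteq> a \<or> d \<noteq> b" for c d
    using root_of_eq_iff[OF ab(3), of c d] that by metis
  show ?thesis
  proof
    show "odd_reflection m n (root_of a b) (adjacent_roots m n p) \<subseteq> adjacent_roots m n ?p'"
    proof
      fix x assume "x \<in> odd_reflection m n (root_of a b) (adjacent_roots m n p)"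
      then consider "x = - root_of a b"
        | c d where "x = root_of c d" "c \<in> idx m n" "d \<in> idx m n" "p d = p c + 1"
            "root_of c d \<noteq> root_of a b" "form m n (root_of c d) (root_of a b) = 0"
        | c d where "x = root_of c d + root_of a b" "c \<in> idx m n" "d \<in> idx m n" "p d = p c + 1"
            "root_of c d \<noteq> root_of a b" "form m n (root_of c d) (root_of a b) \<noteq> 0"
        by (auto simp: odd_reflection_def adjacent_roots_def)
      then show "x \<in> adjacent_roots m n ?p'"
      proof cases
        case 1
        then show ?thesis unfolding 1 uminus_root_of two using ab adj by auto
      next
        case (2 c d)
        have "c \<noteq> a" using 2 adj ab eq[of d b] by auto
        moreover have "d \<noteq> b" using 2 adj ab eq[of c a] by auto
        moreover have "c \<noteq> b" "d \<noteq> a" using 2(4,6) calculation ab adj unfolding form by auto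
        ultimately have "?p' d = ?p' c + 1" using 2 by simp
        then show ?thesis using 2 two by blast
      next
        case (3 c d)
        have "c \<noteq> a" using 3 adj ab eq[of d b] by auto
        moreover have "d \<noteq> b" using 3 adj ab eq[of c a] by auto
        ultimately consider "d = a" "c \<noteq> b" | "c = b" "d \<noteq> a" using 3(4,6) adj unfolding form by fastforce
        then show ?thesis
        proof cases
          case 1
          then have "x = root_of c b" using 3(1) by (simp add: root_of_add)
          moreover have "?p' b = ?p' c + 1" using 1 3 ab \<open>c \<noteq> a\<close> by simp
          ultimately show ?thesis using 3 ab two by blast
        next
          case 2
          then have "x = root_of a d" using 3(1) root_of_add[of a b d] by (simp add: add.commute)
          moreover have "?p' d = ?p' a + 1" using 2 3 ab \<open>d \<noteq> b\<close> by simp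
          ultimately show ?thesis using 3 ab two by blast
        qed
      qed
    qed
  next
    show "adjacent_roots m n ?p' \<subseteq> odd_reflection m n (root_of a b) (adjacent_roots m n p)"
    proof
      fix x assume "x \<in> adjacent_roots m n ?p'"
      then obtain c d where x: "x = root_of c d" and cd: "c \<in> idx m n" "d \<in> idx m n" "?p' d = ?p' c + 1"
        by (auto simp: adjacent_roots_def)
      have reflected: "\<gamma> + root_of a b \<in> odd_reflection m n (root_of a b) (adjacent_roots m n p)"
        if "\<gamma> \<in> adjacent_roots m n p" "\<gamma> \<noteq> root_of a b" "form m n \<gamma> (root_of a b) \<noteq> 0" for \<gamma>
        using that by (auto simp: odd_reflection_def)
      consider "c = b" | "c = a" | "c \<noteq> a" "c \<noteq> b" "d = b" | "c \<noteq> a" "c \<noteq> b" "d = a"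
        | "c \<noteq> a" "c \<noteq> b" "d \<noteq> a" "d \<noteq> b" by blast
      then show "x \<in> odd_reflection m n (root_of a b) (adjacent_roots m n p)"
      proof cases
        case 1
        then have "d = a" using cd ab adj eq[of d b] by (auto split: if_splits)
        then show ?thesis using 1 x by (simp add: odd_reflection_def uminus_root_of)
      next
        case 2
        then have d: "d \<noteq> a" "d \<noteq> b" "p d = p b + 1" using cd ab adj by (auto split: if_splits)
        then have "root_of b d + root_of a b \<in> odd_reflection m n (root_of a b) (adjacent_roots m n p)"
          using cd ab by (intro reflected root_ne) (auto simp: one form)
        then show ?thesis using x 2 root_of_add[of a b d] by (simp add: add.commute)
      next
        case 3
        then have "p a = p c + 1" using cd ab by auto
        then have "root_of c a + root_of a b \<in> odd_reflection m n (root_of a b) (adjacent_roots m n p)"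
          using cd ab 3 by (intro reflected root_ne) (auto simp: one form)
        then show ?thesis using x 3 by (simp add: root_of_add)
      next
        case 4
        then have "p c = p a" using cd ab adj by auto
        then show ?thesis using 4 cd ab eq by blast
      next
        case 5
        then have "p d = p c + 1" using cd by auto
        then have "root_of c d \<in> adjacent_roots m n p" using cd by (simp add: one)
        moreover have "root_of c d \<noteq> root_of a b" using 5 by (intro root_ne) auto
        moreover have "form m n (root_of c d) (root_of a b) = 0" using 5 by (simp add: form)
        ultimately show ?thesis using x by (simp add: odd_reflection_def)
      qed
    qed
  qed
qed

section \<open>The distinguished base: all \<epsilon> before all \<delta>\<close>

definition dist_place :: "nat \<Rightarrow> int \<Rightarrow> int" where
  "dist_place m a = (if a < 0 then int m - a - 1 else a - 1)"

lemma shuffle_dist_place: "shuffle m n (dist_place m)"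
proof -
  have "placement m n (dist_place m)"
    by (rule placementI) (auto simp: dist_place_def inj_on_def idx_def)
  then show ?thesis by (auto simp: shuffle_def dist_place_def intro!: strict_mono_onI)
qed

lemma dist_base_eq: "dist_base m n = adjacent_roots m n (dist_place m)"
proof
  show "dist_base m n \<subseteq> adjacent_roots m n (dist_place m)"
    unfolding dist_base_def eps_diff delta_diff eps_diff_delta
    by (auto simp: root_of_in_adjacent_roots idx_def dist_place_def split: if_splits)
  show "adjacent_roots m n (dist_place m) \<subseteq> dist_base m n"
  proof
    fix x assume "x \<in> adjacent_roots m n (dist_place m)"
    then obtain a b where x: "x = root_of a b" and ab: "a \<in> idx m n" "b \<in> idx m n"
      and adj: "dist_place m b = dist_place m a + 1" by (auto simp: adjacent_roots_def)
    consider "1 \<le> a" "a < int m" "b = a + 1" | "a = int m" "b = - 1" "1 \<le> m" "1 \<le> n"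
      | "1 \<le> - a" "- a < int n" "- b = - a + 1"
      using ab adj by (auto simp: idx_def dist_place_def split: if_splits)
    then show "x \<in> dist_base m n"
    proof cases
      case 1
      then show ?thesis unfolding x dist_base_def eps_diff by auto
    next
      case 2
      then show ?thesis unfolding x dist_base_def eps_diff_delta by auto
    next
      case 3
      have "x = delta (- a) - delta (- b)" by (simp add: x delta_diff)
      then have "x = delta (- a) - delta (- a + 1)" using 3(3) by simp
      then show ?thesis using 3 unfolding dist_base_def by blast
    qed
  qed
qed


section \<open>Highest weight vectors\<close>

context gl_supermodule
begin

section \<open>The action of elementary matrices\<close>

lemma elem_mat_gl [simp]: "a \<in> idx m n \<Longrightarrow> b \<in> idx m n \<Longrightarrow> elem_mat a b \<in> gl m n"
  by (auto simp: gl_def elem_mat_def)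

lemma elem_mat_gl_part:
  "a \<in> idx m n \<Longrightarrow> b \<in> idx m n \<Longrightarrow> elem_mat a b \<in> gl_part m n ((a < 0) \<noteq> (b < 0))"
  using elem_mat_gl[of a b] by (auto simp: gl_part_def elem_mat_def split: if_splits)

lemma gl_scale: "X \<in> gl m n \<Longrightarrow> (\<lambda>x y. c * X x y) \<in> gl m n"
  by (auto simp: gl_def)

lemma gl_add:
  assumes "X \<in> gl m n" "Y \<in> gl m n"
  shows "(\<lambda>x y. X x y + Y x y) \<in> gl m n"
  unfolding gl_def
proof (intro CollectI allI impI)
  fix a b assume "X a b + Y a b \<noteq> 0"
  then have "X a b \<noteq> 0 \<or> Y a b \<noteq> 0" by auto
  then show "a \<in> idx m n \<and> b \<in> idx m n" using assms by (auto simp: gl_def)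
qed

lemma act_vadd: "X \<in> gl m n \<Longrightarrow> act X (u + v) = act X u + act X v"
  using act_linear[of X] by (simp add: Vector_Spaces.linear_iff)

lemma act_vscale: "X \<in> gl m n \<Longrightarrow> act X (scale c u) = scale c (act X u)"
  using act_linear[of X] by (simp add: Vector_Spaces.linear_iff)

lemma act_vzero [simp]: "X \<in> gl m n \<Longrightarrow> act X 0 = 0"
  using act_vscale[of X 0 0] by simp

lemma act_zero: "act (\<lambda>x y. 0) v = 0"
proof -
  have "(\<lambda>x y. 0) \<in> gl m n" by (simp add: gl_def)
  from act_scale[OF this, of 0 v] show ?thesis by simp
qed

text \<open>Reduces stability of a subspace under \<open>gl m n\<close> to stability under
  elementary matrices.\<close>

lemma act_expand:
  assumes "X \<in> gl m n"
  shows "act X v = (\<Sum>t\<in>idx m n \<times> idx m n. scale (X (fst t) (snd t)) (act (elem_mat (fst t) (snd t)) v))"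
proof -
  have "(\<lambda>x y. \<Sum>t\<in>S. X (fst t) (snd t) * elem_mat (fst t) (snd t) x y) \<in> gl m n \<and>
      act (\<lambda>x y. \<Sum>t\<in>S. X (fst t) (snd t) * elem_mat (fst t) (snd t) x y) v =
      (\<Sum>t\<in>S. scale (X (fst t) (snd t)) (act (elem_mat (fst t) (snd t)) v))"
    if "finite S" "S \<subseteq> idx m n \<times> idx m n" for S
    using that
  proof (induction S)
    case empty
    then show ?case by (simp add: act_zero gl_def)
  next
    case (insert t S)
    then have t: "elem_mat (fst t) (snd t) \<in> gl m n" by auto
    show ?case
      using insert gl_scale[OF t] by (simp add: act_add act_scale[OF t] gl_add)
  qed
  then have "act (\<lambda>x y. \<Sum>t\<in>idx m n \<times> idx m n. X (fst t) (snd t) * elem_mat (fst t) (snd t) x y) v =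
      (\<Sum>t\<in>idx m n \<times> idx m n. scale (X (fst t) (snd t)) (act (elem_mat (fst t) (snd t)) v))"
    by simp
  moreover have "(\<lambda>x y. \<Sum>t\<in>idx m n \<times> idx m n. X (fst t) (snd t) * elem_mat (fst t) (snd t) x y) = X"
  proof (intro ext)
    fix x y
    have "(\<Sum>t\<in>idx m n \<times> idx m n. X (fst t) (snd t) * elem_mat (fst t) (snd t) x y) =
        (\<Sum>t\<in>idx m n \<times> idx m n. if t = (x, y) then X x y else 0)"
      by (rule sum.cong) (auto simp: elem_mat_def)
    also have "\<dots> = X x y" using assms by (auto simp: gl_def)
    finally show "(\<Sum>t\<in>idx m n \<times> idx m n. X (fst t) (snd t) * elem_mat (fst t) (snd t) x y) = X x y" .
  qed
  ultimately show ?thesis by simp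
qed

text \<open>The superbracket of two elementary matrices has at most two terms, each again an
  elementary matrix up to sign; solved for the first product, this moves \<open>elem_mat a b\<close>
  to the right.\<close>

lemma act_commute:
  assumes "a \<in> idx m n" "b \<in> idx m n" "c \<in> idx m n" "d \<in> idx m n"
  defines "s \<equiv> super_sign ((a < 0) \<noteq> (b < 0)) ((c < 0) \<noteq> (d < 0))"
  shows "act (elem_mat a b) (act (elem_mat c d) v) =
    scale s (act (elem_mat c d) (act (elem_mat a b) v)) +
    (if b = c then act (elem_mat a d) v else 0) - (if a = d then scale s (act (elem_mat c b) v) else 0)"
proof -
  have mult: "mat_mult m n (elem_mat a b) (elem_mat c d) = (\<lambda>x y. of_bool (b = c) * elem_mat a d x y)"
    if "b \<in> idx m n" for a b c d
  proof (intro ext)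
    fix x y
    have "mat_mult m n (elem_mat a b) (elem_mat c d) x y =
        (\<Sum>z\<in>idx m n. if z = b then of_bool (b = c) * elem_mat a d x y else 0)"
      unfolding mat_mult_def by (rule sum.cong) (auto simp: elem_mat_def)
    then show "mat_mult m n (elem_mat a b) (elem_mat c d) x y = of_bool (b = c) * elem_mat a d x y"
      using that by simp
  qed
  have "super_bracket m n ((a < 0) \<noteq> (b < 0)) ((c < 0) \<noteq> (d < 0)) (elem_mat a b) (elem_mat c d) =
      (\<lambda>x y. of_bool (b = c) * elem_mat a d x y + (- s * of_bool (a = d)) * elem_mat c b x y)"
    unfolding super_bracket_def mult[OF assms(2)] mult[OF assms(4)] s_def by (auto simp: fun_eq_iff)
  then have "act (super_bracket m n ((a < 0) \<noteq> (b < 0)) ((c < 0) \<noteq> (d < 0)) (elem_mat a b) (elem_mat c d)) v =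
      scale (of_bool (b = c)) (act (elem_mat a d) v) + scale (- s * of_bool (a = d)) (act (elem_mat c b) v)"
  proof (simp only:)
    have ad: "elem_mat a d \<in> gl m n" and cb: "elem_mat c b \<in> gl m n" using assms by auto
    show "act (\<lambda>x y. of_bool (b = c) * elem_mat a d x y + (- s * of_bool (a = d)) * elem_mat c b x y) v =
        scale (of_bool (b = c)) (act (elem_mat a d) v) + scale (- s * of_bool (a = d)) (act (elem_mat c b) v)"
      by (simp only: act_add[OF gl_scale[OF ad] gl_scale[OF cb]] act_scale[OF ad] act_scale[OF cb])
  qed
  moreover have "act (super_bracket m n ((a < 0) \<noteq> (b < 0)) ((c < 0) \<noteq> (d < 0)) (elem_mat a b) (elem_mat c d)) v =
      act (elem_mat a b) (act (elem_mat c d) v) - scale s (act (elem_mat c d) (act (elem_mat a b) v))"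
    unfolding s_def using assms by (intro act_bracket elem_mat_gl_part)
  ultimately have "act (elem_mat a b) (act (elem_mat c d) v) =
      scale s (act (elem_mat c d) (act (elem_mat a b) v)) +
      (scale (of_bool (b = c)) (act (elem_mat a d) v) + scale (- s * of_bool (a = d)) (act (elem_mat c b) v))"
    by (metis add.commute diff_add_cancel)
  then show ?thesis by (cases "b = c"; cases "a = d") simp_all
qed

definition weight_vec :: "weight \<Rightarrow> 'v \<Rightarrow> bool" where
  "weight_vec \<mu> v \<longleftrightarrow> (\<forall>a\<in>idx m n. act (elem_mat a a) v = scale (\<mu> a) v)"

text \<open>
  A positive system is encoded by a function \<open>p\<close> that places the indices in a row: the root
  \<open>root_of a b\<close> is positive iff \<open>p a < p b\<close>.
\<close>

definition highest_vec :: "(int \<Rightarrow> int) \<Rightarrow> weight \<Rightarrow> 'v \<Rightarrow> bool" where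
  "highest_vec p \<mu> v \<longleftrightarrow> v \<noteq> 0 \<and> weight_vec \<mu> v \<and>
     (\<forall>a\<in>idx m n. \<forall>b\<in>idx m n. p a < p b \<longrightarrow> act (elem_mat a b) v = 0)"

lemma weight_vec_act:
  assumes "weight_vec \<mu> v" "a \<in> idx m n" "b \<in> idx m n"
  shows "weight_vec (\<mu> + root_of a b) (act (elem_mat a b) v)"
  unfolding weight_vec_def
proof
  fix c assume c: "c \<in> idx m n"
  have "act (elem_mat c c) (act (elem_mat a b) v) =
      scale (\<mu> c) (act (elem_mat a b) v) +
      (if c = a then act (elem_mat a b) v else 0) - (if c = b then act (elem_mat a b) v else 0)"
    using act_commute[OF c c assms(2,3), of v] assms c
    by (auto simp: weight_vec_def super_sign_def act_vscale)
  then show "act (elem_mat c c) (act (elem_mat a b) v) = scale ((\<mu> + root_of a b) c) (act (elem_mat a b) v)"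
    by (auto simp: root_of_def scale_left_distrib scale_left_diff_distrib)
qed

lemma weight_vec_unique:
  assumes "weight_vec \<mu> v" "weight_vec \<nu> v" "v \<noteq> 0" "\<mu> \<in> weights m n" "\<nu> \<in> weights m n"
  shows "\<mu> = \<nu>"
proof
  fix a show "\<mu> a = \<nu> a"
    using assms by (cases "a \<in> idx m n") (auto simp: weight_vec_def weights_def)
qed

section \<open>Parity components of highest weight vectors\<close>

lemma parts_sum_zero:
  assumes "u \<in> V q" "v \<in> V (\<not> q)" "u + v = 0"
  shows "u = 0" "v = 0"
proof -
  have "u = - v" using assms(3) by (simp add: eq_neg_iff_add_eq_0)
  then have "u \<in> V (\<not> q)" using subspace_neg[OF subspace_part assms(2)] by simp
  then have "u \<in> V False \<inter> V True" using assms(1) by (cases q) auto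
  then show "u = 0" using parts_disjoint by simp
  then show "v = 0" using assms(3) by simp
qed

text \<open>Elementary matrices are homogeneous, so every equation for \<open>v\<close> holds for
  both parity components separately, and one of these is nonzero. A homogeneous vector is wanted
  because submodules have to be graded.\<close>

lemma homogeneous_highest_vec:
  assumes "highest_vec p \<mu> v"
  obtains w q where "highest_vec p \<mu> w" "w \<in> V q"
proof -
  obtain v0 v1 where v: "v0 \<in> V False" "v1 \<in> V True" "v = v0 + v1" using parts_span by blast
  have kill: "act (elem_mat a b) v0 = 0 \<and> act (elem_mat a b) v1 = 0"
    if "a \<in> idx m n" "b \<in> idx m n" "act (elem_mat a b) v = 0" for a b
  proof -
    let ?q = "(a < 0) \<noteq> (b < 0)"
    have "act (elem_mat a b) v0 \<in> V ?q" "act (elem_mat a b) v1 \<in> V (\<not> ?q)"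
      using act_parity[OF elem_mat_gl_part[OF that(1,2)] v(1)]
        act_parity[OF elem_mat_gl_part[OF that(1,2)] v(2)] by simp_all
    then show ?thesis
      using parts_sum_zero[of "act (elem_mat a b) v0" ?q "act (elem_mat a b) v1"] that v(3)
      by (simp add: act_vadd)
  qed
  have eigen: "act (elem_mat a a) v0 = scale (\<mu> a) v0 \<and> act (elem_mat a a) v1 = scale (\<mu> a) v1"
    if a: "a \<in> idx m n" for a
  proof -
    have "act (elem_mat a a) v0 \<in> V False" "act (elem_mat a a) v1 \<in> V True"
      using act_parity[OF elem_mat_gl_part[OF a a] v(1)]
        act_parity[OF elem_mat_gl_part[OF a a] v(2)] by simp_all
    then have "act (elem_mat a a) v0 - scale (\<mu> a) v0 \<in> V False"
      "act (elem_mat a a) v1 - scale (\<mu> a) v1 \<in> V (\<not> False)"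
      using v subspace_diff[OF subspace_part] subspace_scale[OF subspace_part] by auto
    moreover have "(act (elem_mat a a) v0 - scale (\<mu> a) v0) + (act (elem_mat a a) v1 - scale (\<mu> a) v1) = 0"
      using assms a v(3) by (simp add: highest_vec_def weight_vec_def act_vadd scale_right_distrib algebra_simps)
    ultimately show ?thesis using parts_sum_zero by fastforce
  qed
  have "highest_vec p \<mu> v0 \<or> highest_vec p \<mu> v1"
    using assms kill eigen v(3) by (auto simp: highest_vec_def weight_vec_def)
  then show thesis using that v by blast
qed

section \<open>The submodule spanned by descendants\<close>

inductive descendant :: "(int \<Rightarrow> int) \<Rightarrow> weight \<Rightarrow> 'v \<Rightarrow> weight \<Rightarrow> 'v \<Rightarrow> bool" for p \<mu> w where
  root: "descendant p \<mu> w \<mu> w"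
| lower: "descendant p \<mu> w \<nu> u \<Longrightarrow> a \<in> idx m n \<Longrightarrow> b \<in> idx m n \<Longrightarrow> p b < p a \<Longrightarrow>
    descendant p \<mu> w (\<nu> + root_of a b) (act (elem_mat a b) u)"

definition descendant_span :: "(int \<Rightarrow> int) \<Rightarrow> weight \<Rightarrow> 'v \<Rightarrow> 'v set" where
  "descendant_span p \<mu> w = span {u. \<exists>\<nu>. descendant p \<mu> w \<nu> u}"

text \<open>The weight is an argument of \<open>descendant\<close> because the vector may be 0 and
  then does not determine it.\<close>

lemma descendant_weight:
  assumes "descendant p \<mu> w \<nu> u" "weight_vec \<mu> w"
  shows "weight_vec \<nu> u"
  using assms by induction (auto intro: weight_vec_act)

lemma descendant_homogeneous:
  assumes "descendant p \<mu> w \<nu> u" "w \<in> V q"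
  shows "\<exists>q'. u \<in> V q'"
  using assms by induction (auto intro: act_parity[OF elem_mat_gl_part])

lemma descendant_in_span: "descendant p \<mu> w \<nu> u \<Longrightarrow> u \<in> descendant_span p \<mu> w"
  unfolding descendant_span_def by (rule span_base) auto

lemma subspace_descendant_span: "subspace (descendant_span p \<mu> w)"
  by (simp add: descendant_span_def)

lemma lower_descendant_span:
  assumes "u \<in> descendant_span p \<mu> w" "a \<in> idx m n" "b \<in> idx m n" "p b < p a"
  shows "act (elem_mat a b) u \<in> descendant_span p \<mu> w"
  using assms(1) unfolding descendant_span_def
proof (induction rule: span_induct_alt)
  case base
  then show ?case using assms by (simp add: span_zero)
next
  case (step c x y)
  then obtain \<nu> where "descendant p \<mu> w \<nu> x" by auto
  then have "act (elem_mat a b) x \<in> span {u. \<exists>\<nu>. descendant p \<mu> w \<nu> u}"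
    using assms by (intro span_base) (auto intro: lower)
  then show ?case
    using step assms by (simp add: act_vadd act_vscale span_add span_scale)
qed

text \<open>Induction on the word of lowering operators, with all elementary matrices treated at
  once. Moving \<open>elem_mat a b\<close> past the outermost operator leaves bracket terms that act
  on a shorter descendant, and the induction hypothesis covers these whatever their
  direction.\<close>

lemma act_descendant:
  assumes inj: "inj_on p (idx m n)" and w: "highest_vec p \<mu> w"
    and u: "descendant p \<mu> w \<nu> u" and "a \<in> idx m n" "b \<in> idx m n"
  shows "act (elem_mat a b) u \<in> descendant_span p \<mu> w"
  using u assms(4,5)
proof (induction arbitrary: a b)
  case root
  consider "a = b" | "p a < p b" | "p b < p a"
    using inj root by (meson inj_onD linorder_neqE)
  then show ?case
  proof cases
    case 1
    then have "act (elem_mat a b) w = scale (\<mu> a) w"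
      using w root by (auto simp: highest_vec_def weight_vec_def)
    then show ?thesis
      using descendant_in_span[OF descendant.root] subspace_scale[OF subspace_descendant_span] by simp
  next
    case 2
    then have "act (elem_mat a b) w = 0" using w root by (auto simp: highest_vec_def)
    then show ?thesis using subspace_0[OF subspace_descendant_span] by simp
  next
    case 3
    then show ?thesis
      using root by (intro lower_descendant_span descendant_in_span[OF descendant.root])
  qed
next
  case (lower \<nu> u c d)
  let ?W = "descendant_span p \<mu> w"
  note sub = subspace_descendant_span[of p \<mu> w]
  let ?s = "super_sign ((a < 0) \<noteq> (b < 0)) ((c < 0) \<noteq> (d < 0))"
  \<comment> \<open>By the induction hypothesis the inner vector lies in the span, and lowering
    operators preserve the span.\<close>
  have "act (elem_mat c d) (act (elem_mat a b) u) \<in> ?W"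
    by (rule lower_descendant_span[where p = p, OF lower.IH[OF lower.prems] lower(2-4)])
  moreover have "(if b = c then act (elem_mat a d) u else 0) \<in> ?W"
    "(if a = d then scale ?s (act (elem_mat c b) u) else 0) \<in> ?W"
    using lower subspace_0[OF sub] subspace_scale[OF sub] by auto
  ultimately show ?case
    using act_commute[of a b c d u] lower(2,3,6,7)
    by (simp only:) (intro subspace_diff[OF sub] subspace_add[OF sub] subspace_scale[OF sub])
qed

text \<open>Stability is checked on elementary matrices. The span is graded because the descendants
  of a homogeneous vector are homogeneous.\<close>

lemma descendant_span_submodule:
  assumes inj: "inj_on p (idx m n)" and w: "highest_vec p \<mu> w" "w \<in> V q"
  shows "gl_submodule scale m n V act (descendant_span p \<mu> w)"
proof -
  let ?W = "descendant_span p \<mu> w"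
  note sub = subspace_descendant_span[of p \<mu> w]
  have elem: "act (elem_mat a b) u \<in> ?W" if u: "u \<in> ?W" and ab: "a \<in> idx m n" "b \<in> idx m n" for a b u
    using u unfolding descendant_span_def
  proof (induction rule: span_induct_alt)
    case base
    then show ?case using ab by (simp add: span_zero)
  next
    case (step c x y)
    then have "act (elem_mat a b) x \<in> span {u. \<exists>\<nu>. descendant p \<mu> w \<nu> u}"
      using act_descendant[OF inj w(1) _ ab] unfolding descendant_span_def by auto
    then show ?case
      using step ab by (simp add: act_vadd act_vscale span_add span_scale)
  qed
  have "act X u \<in> ?W" if "X \<in> gl m n" "u \<in> ?W" for X u
    unfolding act_expand[OF that(1)]
    using elem that by (intro subspace_sum[OF sub] subspace_scale[OF sub]) auto
  moreover have "\<exists>u0\<in>?W \<inter> V False. \<exists>u1\<in>?W \<inter> V True. u = u0 + u1" if "u \<in> ?W" for u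
    using that[unfolded descendant_span_def]
  proof (induction rule: span_induct_alt)
    case base
    then show ?case
      using subspace_0[OF sub] subspace_0[OF subspace_part] by (intro bexI[of _ 0]) auto
  next
    case (step c x y)
    then obtain \<nu> y0 y1 where x: "descendant p \<mu> w \<nu> x"
      and y: "y0 \<in> ?W \<inter> V False" "y1 \<in> ?W \<inter> V True" "y = y0 + y1" by blast
    obtain q' where q': "x \<in> V q'" using descendant_homogeneous[OF x w(2)] by blast
    have cx: "scale c x \<in> ?W \<inter> V q'"
      using descendant_in_span[OF x] q' subspace_scale[OF sub] subspace_scale[OF subspace_part] by auto
    show ?case
    proof (cases q')
      case True
      then have "scale c x + y1 \<in> ?W \<inter> V True"
        using cx y subspace_add[OF sub] subspace_add[OF subspace_part] by auto
      then show ?thesis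
        using y by (intro bexI[of _ y0] bexI[of _ "scale c x + y1"]) (auto simp: algebra_simps)
    next
      case False
      then have "scale c x + y0 \<in> ?W \<inter> V False"
        using cx y subspace_add[OF sub] subspace_add[OF subspace_part] by auto
      then show ?thesis
        using y by (intro bexI[of _ "scale c x + y0"] bexI[of _ y1]) (auto simp: algebra_simps)
    qed
  qed
  ultimately show ?thesis using sub by (simp add: gl_submodule_def)
qed

section \<open>Separating weights by height\<close>

definition height_op :: "(int \<Rightarrow> int) \<Rightarrow> 'v \<Rightarrow> 'v" where
  "height_op p v = (\<Sum>c\<in>idx m n. scale (of_int (- p c)) (act (elem_mat c c) v))"

lemma height_add_root:
  assumes "a \<in> idx m n" "b \<in> idx m n"
  shows "height m n p (\<mu> + root_of a b) = height m n p \<mu> - of_int (p a - p b)"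
  using assms by (simp add: height_add height_root_of)

text \<open>\<open>height_op\<close> is the action of the diagonal matrix with entries
  \<open>- p c\<close>, which has weight vectors as eigenvectors.\<close>

lemma height_op_weight_vec: "weight_vec \<mu> v \<Longrightarrow> height_op p v = scale (height m n p \<mu>) v"
  by (simp add: height_op_def height_def weight_vec_def scale_sum_left)

lemma height_op_add: "height_op p (u + v) = height_op p u + height_op p v"
  unfolding height_op_def sum.distrib[symmetric]
  by (rule sum.cong) (simp_all add: act_vadd scale_right_distrib)

lemma height_op_scale: "height_op p (scale c v) = scale c (height_op p v)"
  by (simp add: height_op_def act_vscale scale_sum_right mult.commute)

lemma descendant_height:
  assumes "descendant p \<mu> w \<nu> u"
  shows "u = w \<or> (\<exists>k::nat. k \<ge> 1 \<and> height m n p \<nu> = height m n p \<mu> - of_nat k)"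
proof -
  \<comment> \<open>Recording \<open>\<nu> = \<mu>\<close> in the first case supplies the height
    from which the first lowering operator starts.\<close>
  have "(u = w \<and> \<nu> = \<mu>) \<or> (\<exists>k::nat. k \<ge> 1 \<and> height m n p \<nu> = height m n p \<mu> - of_nat k)"
    using assms
  proof induction
    case (lower \<nu> u a b)
    then obtain k :: nat where k: "height m n p \<nu> = height m n p \<mu> - of_nat k"
      by (metis diff_zero of_nat_0)
    have "height m n p (\<nu> + root_of a b) = height m n p \<mu> - of_nat (k + nat (p a - p b))"
      using lower k by (simp add: height_add_root)
    moreover have "k + nat (p a - p b) \<ge> 1" using lower by simp
    ultimately show ?case by blast
  qed simp
  then show ?thesis by blast
qed

text \<open>If \<open>c\<close> is the height of a highest weight, this kills its descendants of depth \<open>1, \<dots>, K\<close>.\<close>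

primrec kill :: "(int \<Rightarrow> int) \<Rightarrow> complex \<Rightarrow> nat \<Rightarrow> 'v \<Rightarrow> 'v" where
  "kill p c 0 v = v"
| "kill p c (Suc K) v = height_op p (kill p c K v) - scale (c - of_nat (Suc K)) (kill p c K v)"

lemma kill_add: "kill p c K (u + v) = kill p c K u + kill p c K v"
  by (induction K) (auto simp: height_op_add scale_right_distrib)

lemma kill_scale: "kill p c K (scale a v) = scale a (kill p c K v)"
  by (induction K) (auto simp: height_op_scale scale_right_diff_distrib mult.commute)

lemma kill_mono:
  assumes "K \<le> K'" "kill p c K v = 0"
  shows "kill p c K' v = 0"
proof -
  have "height_op p 0 = 0" using height_op_scale[of p 0 0] by simp
  with assms show ?thesis by (induction K' rule: dec_induct) auto
qed

lemma kill_eigen: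
  assumes "height_op p v = scale e v"
  shows "kill p c K v = scale (\<Prod>k=1..K. e - (c - of_nat k)) v"
proof (induction K)
  case (Suc K)
  define P where "P = (\<Prod>k=1..K. e - (c - of_nat k))"
  have "kill p c (Suc K) v = scale (P * e) v - scale ((c - of_nat (Suc K)) * P) v"
    using Suc[folded P_def] by (simp add: height_op_scale assms)
  also have "\<dots> = scale (P * (e - (c - of_nat (Suc K)))) v"
    by (subst scale_left_diff_distrib[symmetric], rule arg_cong[where f = "\<lambda>x. scale x v"])
      (simp add: algebra_simps)
  finally show ?case by (simp add: P_def)
qed simp

text \<open>A descendant different from \<open>w\<close> lies at some depth \<open>k\<close> of at
  least 1 and is killed by the factor for \<open>k\<close>. A linear combination involves finitely
  many depths, so a large \<open>K\<close> kills all of it except a multiple of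
  \<open>w\<close>.\<close>

lemma kill_descendant_span:
  assumes u: "u \<in> descendant_span p \<mu> w" and w: "weight_vec \<mu> w"
  shows "\<exists>a K. kill p (height m n p \<mu>) K (u - scale a w) = 0"
  using u unfolding descendant_span_def
proof (induction rule: span_induct_alt)
  case base
  show ?case by (intro exI[of _ 0]) auto
next
  case (step c x y)
  let ?kill = "kill p (height m n p \<mu>)"
  obtain \<nu> where x: "descendant p \<mu> w \<nu> x" using step by auto
  obtain a K where y: "?kill K (y - scale a w) = 0" using step by auto
  have "\<exists>a' K'. ?kill K' (x - scale a' w) = 0"
  proof (cases "x = w")
    case True
    then show ?thesis by (intro exI[of _ 1] exI[of _ 0]) simp
  next
    case False
    then obtain k :: nat where k: "k \<ge> 1" "height m n p \<nu> = height m n p \<mu> - of_nat k"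
      using descendant_height[OF x] by blast
    have "?kill k x = 0"
      unfolding kill_eigen[OF height_op_weight_vec[OF descendant_weight[OF x w]]]
      using k by (auto simp: prod_zero_iff)
    then show ?thesis by (intro exI[of _ 0] exI[of _ k]) simp
  qed
  then obtain a' K' where x': "?kill K' (x - scale a' w) = 0" by blast
  have "?kill (max K K') (scale c (x - scale a' w) + (y - scale a w)) = 0"
    using kill_mono[OF _ x', of "max K K'"] kill_mono[OF _ y, of "max K K'"]
    by (simp add: kill_add kill_scale)
  moreover have "scale c x + y - scale (c * a' + a) w = scale c (x - scale a' w) + (y - scale a w)"
    by (simp add: algebra_simps scale_left_distrib scale_right_diff_distrib)
  ultimately show ?case by metis
qed

text \<open>By simplicity the descendants of a homogeneous highest weight vector span the module, so
  the operator \<open>kill\<close> annihilates \<open>v\<close> up to a multiple of that vector. On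
  \<open>v\<close> it is a scalar: if the scalar is 0, one factor gives the depth; otherwise
  \<open>v\<close> is proportional to the highest weight vector and shares its weight.\<close>

lemma highest_vec_height:
  assumes simple: "\<And>W. gl_submodule scale m n V act W \<Longrightarrow> W = {0} \<or> W = UNIV"
    and inj: "inj_on p (idx m n)"
    and w: "highest_vec p \<mu> w" and v: "weight_vec \<nu> v" "v \<noteq> 0"
    and wts: "\<mu> \<in> weights m n" "\<nu> \<in> weights m n"
  shows "\<nu> = \<mu> \<or> (\<exists>k::nat. k \<ge> 1 \<and> height m n p \<nu> = height m n p \<mu> - of_nat k)"
proof -
  obtain w' q where w': "highest_vec p \<mu> w'" "w' \<in> V q"
    using homogeneous_highest_vec[OF w] by blast
  have wv: "weight_vec \<mu> w'" and nz: "w' \<noteq> 0" using w' by (auto simp: highest_vec_def)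
  have "w' \<in> descendant_span p \<mu> w'" by (rule descendant_in_span[OF root])
  then have "descendant_span p \<mu> w' = UNIV"
    using simple[OF descendant_span_submodule[OF inj w']] nz by auto
  then obtain a K where "kill p (height m n p \<mu>) K (v - scale a w') = 0"
    using kill_descendant_span[OF _ wv] by blast
  then have "kill p (height m n p \<mu>) K (scale 1 v + scale (- a) w') = 0" by simp
  then have eq: "kill p (height m n p \<mu>) K v = scale a (kill p (height m n p \<mu>) K w')"
    unfolding kill_add kill_scale by simp
  show ?thesis
  proof (cases "(\<Prod>k=1..K. height m n p \<nu> - (height m n p \<mu> - of_nat k)) = 0")
    case True
    then obtain k where "k \<in> {1..K}" "height m n p \<nu> - (height m n p \<mu> - of_nat k) = 0"
      by (auto simp: prod_zero_iff)
    then show ?thesis by (intro disjI2 exI[of _ k]) auto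
  next
    case False
    define P where "P = (\<Prod>k=1..K. height m n p \<nu> - (height m n p \<mu> - of_nat k))"
    obtain b where "scale P v = scale b w'"
      using eq unfolding kill_eigen[OF height_op_weight_vec[OF v(1)]]
        kill_eigen[OF height_op_weight_vec[OF wv]] P_def[symmetric] by auto
    then have "scale (inverse P) (scale P v) = scale (inverse P) (scale b w')" by simp
    then have v': "v = scale (inverse P * b) w'" using False by (simp add: P_def)
    have "weight_vec \<mu> v"
      using wv unfolding v' weight_vec_def by (auto simp: act_vscale mult.commute)
    then show ?thesis using weight_vec_unique[OF v(1) _ v(2) wts(2,1)] by simp
  qed
qed

section \<open>Uniqueness of highest weights and odd reflections\<close>

lemma highest_weight_unique:
  assumes simple: "\<And>W. gl_submodule scale m n V act W \<Longrightarrow> W = {0} \<or> W = UNIV"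
    and inj: "inj_on p (idx m n)"
    and "highest_vec p \<mu> v" "\<mu> \<in> weights m n" "highest_vec p \<nu> w" "\<nu> \<in> weights m n"
  shows "\<mu> = \<nu>"
proof (rule ccontr)
  assume ne: "\<mu> \<noteq> \<nu>"
  obtain k :: nat where "k \<ge> 1" "height m n p \<nu> = height m n p \<mu> - of_nat k"
    using highest_vec_height[OF simple inj assms(3), of \<nu> w] assms ne by (auto simp: highest_vec_def)
  moreover obtain l :: nat where "l \<ge> 1" "height m n p \<mu> = height m n p \<nu> - of_nat l"
    using highest_vec_height[OF simple inj assms(5), of \<mu> v] assms ne by (auto simp: highest_vec_def)
  \<comment> \<open>Each of the two weights would lie at positive depth below the other.\<close>
  ultimately have "of_nat (k + l) = (0::complex)" by (simp add: algebra_simps)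
  then show False using \<open>k \<ge> 1\<close> by (simp only: of_nat_eq_0_iff)
qed

text \<open>Let \<open>e\<close> and \<open>f\<close> be the odd root vectors for
  \<open>root_of a b\<close> and its negative. Then \<open>e f v\<close> is
  \<open>\<mu> a + \<mu> b\<close> times \<open>v\<close>. If this scalar is nonzero,
  \<open>f v\<close> is nonzero and is the new highest weight vector. If it is 0, a nonzero
  \<open>f v\<close> would be a second highest weight vector for \<open>p\<close>, against
  uniqueness; so \<open>f v\<close> is 0 and \<open>v\<close> remains highest.\<close>

lemma odd_reflection_highest_vec:
  assumes simple: "\<And>W. gl_submodule scale m n V act W \<Longrightarrow> W = {0} \<or> W = UNIV"
    and inj: "inj_on p (idx m n)"
    and ab: "a \<in> idx m n" "b \<in> idx m n" "(a < 0) \<noteq> (b < 0)" "p b = p a + 1"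
    and v: "highest_vec p \<mu> v" "\<mu> \<in> weights m n"
  defines "\<mu>' \<equiv> if \<mu> a + \<mu> b = 0 then \<mu> else \<mu> - root_of a b"
  shows "\<exists>v'. highest_vec (p(a := p b, b := p a)) \<mu>' v'" "\<mu>' \<in> weights m n"
proof -
  let ?p' = "p(a := p b, b := p a)"
  let ?e = "act (elem_mat a b)" and ?f = "act (elem_mat b a)"
  have neq: "a \<noteq> b" using ab by auto
  have kill: "act (elem_mat c d) v = 0" if "c \<in> idx m n" "d \<in> idx m n" "p c < p d" for c d
    using v that by (auto simp: highest_vec_def)
  have wv: "weight_vec \<mu> v" and nz: "v \<noteq> 0" using v by (auto simp: highest_vec_def)
  have less: "p c < p d" "(c, d) \<noteq> (a, b)"
    if "?p' c < ?p' d" "c \<in> idx m n" "d \<in> idx m n" "(c, d) \<noteq> (b, a)" for c d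
  proof -
    have "c \<noteq> a \<Longrightarrow> p c \<noteq> p a" "c \<noteq> b \<Longrightarrow> p c \<noteq> p b" "d \<noteq> a \<Longrightarrow> p d \<noteq> p a" "d \<noteq> b \<Longrightarrow> p d \<noteq> p b"
      using inj_onD[OF inj _ that(2) ab(1)] inj_onD[OF inj _ that(2) ab(2)]
        inj_onD[OF inj _ that(3) ab(1)] inj_onD[OF inj _ that(3) ab(2)] by metis+
    then show "p c < p d" "(c, d) \<noteq> (a, b)" using that ab neq by (auto split: if_splits)
  qed
  have ef: "?e (?f v) = scale (\<mu> a + \<mu> b) v"
    using act_commute[OF ab(1,2,2,1), of v] kill[OF ab(1,2)] wv ab
    by (auto simp: super_sign_def weight_vec_def scale_left_distrib)
  \<comment> \<open>The commutation rule for the odd operator with itself has sign -1 and, as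
    \<open>a\<close> and \<open>b\<close> differ, no bracket term.\<close>
  have ff: "?f (?f v) = 0"
  proof -
    have "?f (?f v) = - ?f (?f v)"
      using act_commute[OF ab(2,1,2,1), of v] ab neq by (auto simp: super_sign_def)
    then have "scale 2 (?f (?f v)) = 0"
      by (metis add.right_inverse one_add_one scale_left_distrib scale_one)
    then show ?thesis by simp
  qed
  \<comment> \<open>The bracket with \<open>elem_mat b a\<close> leaves \<open>elem_mat c a\<close>
    if \<open>d = b\<close> and \<open>elem_mat b d\<close> if \<open>c = a\<close>. Both are still
    raising operators, since no index stands between \<open>a\<close> and \<open>b\<close>.\<close>
  have cdf: "act (elem_mat c d) (?f v) = 0"
    if cd: "c \<in> idx m n" "d \<in> idx m n" "p c < p d" "(c, d) \<noteq> (a, b)" for c d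
  proof -
    have "c \<noteq> a \<Longrightarrow> p c \<noteq> p a" "d \<noteq> b \<Longrightarrow> p d \<noteq> p b"
      using inj_onD[OF inj _ cd(1) ab(1)] inj_onD[OF inj _ cd(2) ab(2)] by metis+
    then have "d = b \<Longrightarrow> act (elem_mat c a) v = 0" "c = a \<Longrightarrow> act (elem_mat b d) v = 0"
      using cd ab by (auto intro!: kill)
    then show ?thesis
      using act_commute[OF cd(1,2) ab(2,1), of v] kill[OF cd(1,2,3)] ab by auto
  qed
  have wf: "weight_vec (\<mu> - root_of a b) (?f v)"
  proof -
    have "\<mu> + root_of b a = \<mu> - root_of a b" by (auto simp: root_of_def fun_eq_iff)
    then show ?thesis using weight_vec_act[OF wv ab(2,1)] by simp
  qed
  have wts: "\<mu> - root_of a b \<in> weights m n"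
    using v ab by (auto simp: weights_def root_of_def)
  then show "\<mu>' \<in> weights m n" using v by (simp add: \<mu>'_def)
  show "\<exists>v'. highest_vec ?p' \<mu>' v'"
  proof (cases "\<mu> a + \<mu> b = 0")
    case True
    have f0: "?f v = 0"
    proof (rule ccontr)
      assume "?f v \<noteq> 0"
      then have "highest_vec p (\<mu> - root_of a b) (?f v)"
        using wf cdf ef True unfolding highest_vec_def by (metis prod.inject scale_zero_left)
      then have "\<mu> = \<mu> - root_of a b"
        using highest_weight_unique[OF simple inj v _ wts] by blast
      then have "root_of a b a = 0" by (metis diff_add_cancel add_cancel_right_right zero_fun_apply)
      then show False using neq by (simp add: root_of_def)
    qed
    have "act (elem_mat c d) v = 0" if "c \<in> idx m n" "d \<in> idx m n" "?p' c < ?p' d" for c d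
      using f0 kill less[of c d] that by (cases "(c, d) = (b, a)") auto
    then have "highest_vec ?p' \<mu> v" unfolding highest_vec_def using nz wv by blast
    then show ?thesis using True by (auto simp: \<mu>'_def)
  next
    case False
    have "?f v \<noteq> 0"
    proof
      assume "?f v = 0"
      then have "scale (\<mu> a + \<mu> b) v = 0" using ef ab by simp
      then show False using False nz by simp
    qed
    moreover have "act (elem_mat c d) (?f v) = 0" if "c \<in> idx m n" "d \<in> idx m n" "?p' c < ?p' d" for c d
      using ff cdf less[of c d] that by (cases "(c, d) = (b, a)") auto
    ultimately have "highest_vec ?p' (\<mu> - root_of a b) (?f v)"
      unfolding highest_vec_def using wf by blast
    then show ?thesis using False by (auto simp: \<mu>'_def)
  qed
qed

end


section \<open>The arrow diagram\<close>

lemma arrow_end_props: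
  fixes m n x i
  defines "A \<equiv> (\<lambda>j. - x (- j)) ` {1..int n} \<union> arrow_end m n x ` {i<..int m}"
  shows arrow_end_ge: "x i \<le> arrow_end m n x i"
    and arrow_end_notin: "arrow_end m n x i \<notin> A"
    and arrow_end_least: "x i \<le> c \<Longrightarrow> c < arrow_end m n x i \<Longrightarrow> c \<in> A"
proof -
  define P where "P c \<longleftrightarrow> x i \<le> c \<and> c \<notin> A" for c
  have eq: "arrow_end m n x i = (LEAST c. P c)"
    by (subst arrow_end.simps) (rule arg_cong[where f = Least], rule ext, auto simp: P_def A_def)
  \<comment> \<open>Only finitely many integers are blocked, so a free one exists to the right of
    \<open>x i\<close>.\<close>
  have "finite A" by (simp add: A_def)
  moreover have "infinite {x i..}" by (simp add: infinite_Ici)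
  ultimately obtain c0 where "c0 \<in> {x i..}" "c0 \<notin> A"
    by (meson finite_subset subsetI)
  then have c: "P c0" by (simp add: P_def)
  \<comment> \<open>The minimum is taken over the offset from \<open>x i\<close>, a natural number,
    because minima of sets of integers need a lower bound.\<close>
  define N where "N = (LEAST k. P (x i + int k))"
  have ex: "P (x i + int (nat (c0 - x i)))" using c by (simp add: P_def)
  have N: "P (x i + int N)" unfolding N_def by (rule LeastI[of "\<lambda>k. P (x i + int k)", OF ex])
  have low: "x i + int N \<le> d" if "P d" for d
  proof -
    have "P (x i + int (nat (d - x i)))" using that by (simp add: P_def)
    then have "N \<le> nat (d - x i)" unfolding N_def by (rule Least_le)
    moreover have "x i \<le> d" using that by (simp add: P_def)
    ultimately show ?thesis by linarith
  qed
  have "arrow_end m n x i = x i + int N"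
    unfolding eq by (rule Least_equality) (use N low in auto)
  then have P: "P (arrow_end m n x i)" and least: "\<And>d. P d \<Longrightarrow> arrow_end m n x i \<le> d"
    using N low by auto
  show "x i \<le> arrow_end m n x i" "arrow_end m n x i \<notin> A" using P by (simp_all add: P_def)
  show "c \<in> A" if "x i \<le> c" "c < arrow_end m n x i"
    using least[of c] that unfolding P_def by linarith
qed

text \<open>The interval of condition (b). It turns out to consist of those \<delta> that raise the
  value of \<open>\<epsilon>\<^sub>i\<close> when they meet it.\<close>

definition hit :: "nat \<Rightarrow> nat \<Rightarrow> (int \<Rightarrow> int) \<Rightarrow> int \<Rightarrow> int \<Rightarrow> bool" where
  "hit m n x i j \<longleftrightarrow>
     int (arrow_count m n x i) - (arrow_end m n x i - x i - 1) \<le> j \<and> j \<le> int (arrow_count m n x i)"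

section \<open>Increasing integer sequences and climbing\<close>

lemma down_closed_atLeastAtMost:
  fixes n :: int
  assumes "A \<subseteq> {1..n}" and "\<And>i j. j \<in> A \<Longrightarrow> 1 \<le> i \<Longrightarrow> i \<le> j \<Longrightarrow> i \<in> A"
  shows "A = {1..int (card A)}"
proof (cases "A = {}")
  case False
  have fin: "finite A" using assms(1) finite_subset by blast
  have max: "Max A \<in> A" using Max_in[OF fin False] .
  have "A = {1..Max A}"
  proof
    show "A \<subseteq> {1..Max A}" using fin assms(1) by auto
    show "{1..Max A} \<subseteq> A" using assms(2)[OF max] by auto
  qed
  moreover have "int (card {1..Max A}) = Max A" using max assms(1) by auto
  ultimately show ?thesis by metis
qed auto

text \<open>The members of the sequence below a bound form an initial segment, so their number tells
  which ones they are.\<close>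

lemma strict_mono_on_count_less:
  fixes Y :: "int \<Rightarrow> int"
  assumes "strict_mono_on {1..n} Y" "j \<in> {1..n}"
  shows "Y j < c \<longleftrightarrow> j \<le> int (card {j \<in> {1..n}. Y j < c})"
proof -
  have "{j \<in> {1..n}. Y j < c} = {1..int (card {j \<in> {1..n}. Y j < c})}"
  proof (rule down_closed_atLeastAtMost)
    fix i j assume *: "j \<in> {j \<in> {1..n}. Y j < c}" "1 \<le> i" "i \<le> j"
    then have "Y i \<le> Y j"
      using assms(1) by (intro strict_mono_on_leD[OF assms(1)]) auto
    then show "i \<in> {j \<in> {1..n}. Y j < c}" using * by auto
  qed auto
  then have "j \<in> {j \<in> {1..n}. Y j < c} \<longleftrightarrow> j \<in> {1..int (card {j \<in> {1..n}. Y j < c})}"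
    by (rule arg_cong)
  then show ?thesis using assms(2) by auto
qed

lemma strict_mono_on_int_gap:
  fixes Y :: "int \<Rightarrow> int"
  assumes mono: "strict_mono_on {1..n} Y" and "1 \<le> i" "i \<le> j" "j \<le> n"
  shows "j - i \<le> Y j - Y i"
  using assms(3,4)
proof (induction j rule: int_ge_induct)
  case (step j)
  then have "Y j < Y (j + 1)" using mono assms(2) by (intro strict_mono_onD[OF mono]) auto
  then show ?case using step by simp
qed simp

text \<open>
  A value that starts at \<open>x\<close> and is raised by one whenever it meets the next member of an increasing
  sequence \<open>Y\<close> climbs to the first integer \<open>k\<close> missing from \<open>Y\<close>; it meets the members with the
  indices \<open>L + 1, \<dots>, M\<close>.
\<close>

lemma climb_row:
  fixes Y :: "int \<Rightarrow> int" and n :: int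
  assumes mono: "strict_mono_on {1..n} Y" and "x \<le> k"
    and full: "\<And>c. x \<le> c \<Longrightarrow> c < k \<Longrightarrow> c \<in> Y ` {1..n}"
  defines "M \<equiv> int (card {j \<in> {1..n}. Y j < k})"
  defines "L \<equiv> M - (k - x)"
  shows "0 \<le> L"
    and "\<And>j. j \<in> {1..n} \<Longrightarrow> Y j < k \<longleftrightarrow> j \<le> M"
    and "\<And>j. j \<in> {1..n} \<Longrightarrow> Y j < x \<longleftrightarrow> j \<le> L"
    and "\<And>j. j \<in> {1..n} \<Longrightarrow> L < j \<Longrightarrow> j \<le> M \<Longrightarrow> Y j = x + (j - L - 1)"
    and "M \<le> max 0 n"
proof -
  have inj: "inj_on Y {1..n}" using mono strict_mono_on_imp_inj_on by blast
  \<comment> \<open>By \<open>full\<close> the sequence takes every value from \<open>x\<close> to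
    \<open>k - 1\<close>; thus \<open>L\<close> is the number of members below
    \<open>x\<close>.\<close>
  have "Y ` {j \<in> {1..n}. x \<le> Y j \<and> Y j < k} = {x..<k}"
    using full by force
  then have "card {j \<in> {1..n}. x \<le> Y j \<and> Y j < k} = nat (k - x)"
    by (metis (no_types, lifting) card_atLeastLessThan_int card_image inj inj_on_subset mem_Collect_eq subsetI)
  moreover have "{j \<in> {1..n}. Y j < k} = {j \<in> {1..n}. Y j < x} \<union> {j \<in> {1..n}. x \<le> Y j \<and> Y j < k}"
    using \<open>x \<le> k\<close> by auto
  then have "card {j \<in> {1..n}. Y j < k} =
      card {j \<in> {1..n}. Y j < x} + card {j \<in> {1..n}. x \<le> Y j \<and> Y j < k}"
    by (simp only:) (rule card_Un_disjoint, auto intro: finite_subset[of _ "{1..n}"])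
  ultimately have L: "L = int (card {j \<in> {1..n}. Y j < x})"
    using \<open>x \<le> k\<close> by (simp add: L_def M_def)
  show "0 \<le> L" by (simp add: L)
  show k: "Y j < k \<longleftrightarrow> j \<le> M" if "j \<in> {1..n}" for j
    unfolding M_def by (rule strict_mono_on_count_less[OF mono that])
  show x: "Y j < x \<longleftrightarrow> j \<le> L" if "j \<in> {1..n}" for j
    unfolding L by (rule strict_mono_on_count_less[OF mono that])
  have "card {j \<in> {1..n}. Y j < k} \<le> card {1..n}" by (rule card_mono) auto
  then show M: "M \<le> max 0 n" by (simp add: M_def)
  show "Y j = x + (j - L - 1)" if "j \<in> {1..n}" "L < j" "j \<le> M" for j
  proof -
    have "x \<le> Y (L + 1)" "Y M < k"
      using x[of "L + 1"] k[of M] that \<open>0 \<le> L\<close> M by auto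
    \<comment> \<open>The members \<open>L + 1\<close> to \<open>M\<close> start at \<open>x\<close>
      or later and end before \<open>k\<close>; as \<open>M - L = k - x\<close>, there is no slack
      and each step is exactly 1.\<close>
    moreover have "j - (L + 1) \<le> Y j - Y (L + 1)" "M - j \<le> Y M - Y j"
      using that \<open>0 \<le> L\<close> M by (auto intro!: strict_mono_on_int_gap[OF mono])
    ultimately show ?thesis by (simp add: L_def)
  qed
qed

section \<open>The hits satisfy the recursion of successive meetings\<close>

context
  fixes m n :: nat and x :: "int \<Rightarrow> int"
  assumes x_dec: "\<And>i. 1 \<le> i \<Longrightarrow> i < int m \<Longrightarrow> x (i + 1) < x i"
    and y_inc: "strict_mono_on {1..int n} (\<lambda>j. - x (- j))"
begin

private abbreviation (input) "y \<equiv> \<lambda>j. - x (- j)"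
private abbreviation (input) "k \<equiv> arrow_end m n x"
private abbreviation (input) "M \<equiv> \<lambda>i. int (arrow_count m n x i)"

text \<open>The value of \<open>- \<delta>\<^sub>j\<close> after its meetings with
  \<open>\<epsilon>\<^sub>m\<close> down to \<open>\<epsilon>\<^sub>i\<^sub>+\<^sub>1\<close>, that
  is, just before it meets \<open>\<epsilon>\<^sub>i\<close>.\<close>

private definition climbed :: "int \<Rightarrow> int \<Rightarrow> int" where
  "climbed i j = y j + int (card {i' \<in> {i<..int m}. hit m n x i' j})"

text \<open>The end of the arrow at \<open>i\<close> is free for the arrow at \<open>i + 1\<close>
  as well and different from its end. If it were smaller, it would contradict minimality
  there.\<close>

private lemma arrow_end_step:
  assumes "1 \<le> i" "i < int m"
  shows "k (i + 1) < k i"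
proof (rule ccontr)
  assume "\<not> k (i + 1) < k i"
  moreover have "k i \<notin> y ` {1..int n} \<union> k ` {i<..int m}" by (rule arrow_end_notin)
  moreover have "x (i + 1) \<le> k i"
    using x_dec[OF assms] arrow_end_ge[of x i m n] by simp
  moreover have "k (i + 1) \<in> k ` {i<..int m}" using assms by auto
  ultimately show False
    using arrow_end_least[of x "i + 1" "k i" m n] by (cases "k i = k (i + 1)") auto
qed

text \<open>The state after the rows \<open>m\<close> down to \<open>i + 1\<close>. To the right of
  \<open>x (i + 1)\<close> the climbed values occupy exactly the integers that are blocked for the
  arrow at \<open>i\<close>; this bound is needed because \<open>x (i + 1)\<close> itself may have
  been vacated.\<close>

private definition inv_at :: "int \<Rightarrow> bool" where
  "inv_at i \<longleftrightarrow> strict_mono_on {1..int n} (climbed i) \<and>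
     (\<forall>c. (i < int m \<longrightarrow> x (i + 1) < c) \<longrightarrow>
        (c \<in> climbed i ` {1..int n} \<longleftrightarrow> c \<in> y ` {1..int n} \<union> k ` {i<..int m})) \<and>
     (\<forall>j\<in>{1..int n}. climbed i j \<noteq> y j \<longrightarrow> i < int m \<and> climbed i j \<le> k (i + 1))"

private lemma climbed_pred:
  assumes "i \<in> {1..int m}"
  shows "climbed (i - 1) j = climbed i j + (if hit m n x i j then 1 else 0)"
proof -
  have "{i' \<in> {i - 1<..int m}. hit m n x i' j} =
      (if hit m n x i j then insert i {i' \<in> {i<..int m}. hit m n x i' j}
       else {i' \<in> {i<..int m}. hit m n x i' j})"
    using assms by auto (use order_le_less in force)+
  moreover have "finite {i' \<in> {i<..int m}. hit m n x i' j}"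
    by (rule finite_subset[of _ "{i<..int m}"]) auto
  ultimately show ?thesis by (simp add: climbed_def)
qed

text \<open>From \<open>x i\<close> on, the integers occupied by climbed values are those blocked
  for the arrow at \<open>i\<close>. Hence \<open>k i\<close> is the first one missing among them,
  and \<open>climb_row\<close> applies.\<close>

private lemma row_facts:
  assumes i: "i \<in> {1..int m}" and inv: "inv_at i"
  defines "L \<equiv> M i - (k i - x i)"
  shows "0 \<le> L" "L \<le> M i" "M i \<le> int n" "k i \<notin> climbed i ` {1..int n}"
    and "\<And>j. j \<in> {1..int n} \<Longrightarrow> climbed i j < k i \<longleftrightarrow> j \<le> M i"
    and "\<And>j. j \<in> {1..int n} \<Longrightarrow> climbed i j < x i \<longleftrightarrow> j \<le> L"
    and "\<And>j. j \<in> {1..int n} \<Longrightarrow> L < j \<Longrightarrow> j \<le> M i \<Longrightarrow> climbed i j = x i + (j - L - 1)"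
proof -
  have set: "c \<in> climbed i ` {1..int n} \<longleftrightarrow> c \<in> y ` {1..int n} \<union> k ` {i<..int m}" if "x i \<le> c" for c
  proof -
    have "i < int m \<longrightarrow> x (i + 1) < c" using x_dec[of i] i that by auto
    then show ?thesis using inv unfolding inv_at_def by blast
  qed
  have le: "x i \<le> k i" by (rule arrow_end_ge)
  show "k i \<notin> climbed i ` {1..int n}" using set[OF le] arrow_end_notin[of m n x i] by blast
  have full: "c \<in> climbed i ` {1..int n}" if "x i \<le> c" "c < k i" for c
    using set[of c] arrow_end_least[of x i c m n] that by blast
  have mono: "strict_mono_on {1..int n} (climbed i)" using inv by (simp add: inv_at_def)
  \<comment> \<open>A value that has moved is at most \<open>k (i + 1)\<close>, which is less than
    \<open>k i\<close>, so the count \<open>M i\<close> may be taken with original or with climbed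
    values.\<close>
  have "climbed i j < k i \<longleftrightarrow> y j < k i" if "j \<in> {1..int n}" for j
  proof -
    have "y j \<le> climbed i j" by (simp add: climbed_def)
    then show ?thesis
      using inv that arrow_end_step[of i] i unfolding inv_at_def by (smt (verit) atLeastAtMost_iff)
  qed
  then have "{j \<in> {1..int n}. climbed i j < k i} = {j \<in> {1..int n}. y j < k i}" by auto
  then have M: "int (card {j \<in> {1..int n}. climbed i j < k i}) = M i"
    by (simp add: arrow_count_def)
  note row = climb_row[OF mono le full, unfolded M, folded L_def]
  show "0 \<le> L" "L \<le> M i" "M i \<le> int n" using row(1,5) le by (auto simp: L_def)
  show "climbed i j < k i \<longleftrightarrow> j \<le> M i" if "j \<in> {1..int n}" for j using row(2) that by blast
  show "climbed i j < x i \<longleftrightarrow> j \<le> L" if "j \<in> {1..int n}" for j using row(3) that by blast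
  show "climbed i j = x i + (j - L - 1)" if "j \<in> {1..int n}" "L < j" "j \<le> M i" for j
    using row(4) that by blast
qed

private lemma hit_iff: "hit m n x i j \<longleftrightarrow> M i - (k i - x i) < j \<and> j \<le> M i"
  by (auto simp: hit_def)

text \<open>Row \<open>i\<close> raises the run of consecutive values \<open>x i\<close> to
  \<open>k i - 1\<close> by one. A nonempty run vacates \<open>x i\<close> and fills
  \<open>k i\<close>; an empty one changes nothing.\<close>

private lemma inv_step:
  assumes i: "i \<in> {1..int m}" and inv: "inv_at i"
  shows "inv_at (i - 1)"
proof -
  define L where "L = M i - (k i - x i)"
  note row = row_facts[OF i inv, folded L_def]
  have hit: "hit m n x i j \<longleftrightarrow> L < j \<and> j \<le> M i" for j by (simp add: hit_iff L_def)
  note pred = climbed_pred[OF i]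
  have mono: "strict_mono_on {1..int n} (climbed i)" using inv by (simp add: inv_at_def)
  \<comment> \<open>No climbed value equals \<open>k i\<close>, so the members after the run leave
    room for its last member to be raised to \<open>k i\<close>.\<close>
  have gt: "k i < climbed i j" if "j \<in> {1..int n}" "M i < j" for j
  proof -
    have "climbed i j \<noteq> k i" using row(4) that(1) by (metis imageI)
    then show ?thesis using row(5)[OF that(1)] that(2) by linarith
  qed
  have "strict_mono_on {1..int n} (climbed (i - 1))"
  proof (rule strict_mono_onI)
    fix r s assume rs: "r \<in> {1..int n}" "s \<in> {1..int n}" "r < s"
    have lt: "climbed i r < climbed i s" using mono rs by (simp add: strict_mono_onD)
    show "climbed (i - 1) r < climbed (i - 1) s"
    proof (cases "hit m n x i r \<and> \<not> hit m n x i s")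
      case True
      then have "M i < s" "r \<le> M i" using rs by (auto simp: hit)
      then show ?thesis using gt[of s] row(5)[of r] rs True by (simp add: pred)
    next
      case False
      then show ?thesis using lt by (auto simp: pred)
    qed
  qed
  moreover have "c \<in> climbed (i - 1) ` {1..int n} \<longleftrightarrow> c \<in> y ` {1..int n} \<union> k ` {i - 1<..int m}"
    if c: "x i < c" for c
  proof -
    \<comment> \<open>Within the run each raised value is the old value of the next member, or
      \<open>k i\<close> for the last one; conversely, each old value above \<open>x i\<close> is
      reached by its predecessor.\<close>
    have "c \<in> climbed (i - 1) ` {1..int n} \<longleftrightarrow> c \<in> climbed i ` {1..int n} \<or> c = k i"
    proof
      assume "c \<in> climbed (i - 1) ` {1..int n}"
      then obtain j where j: "j \<in> {1..int n}" "c = climbed (i - 1) j" by auto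
      show "c \<in> climbed i ` {1..int n} \<or> c = k i"
      proof (cases "hit m n x i j")
        case True
        then have j': "L < j" "j \<le> M i" by (auto simp: hit)
        have c': "c = x i + (j + 1 - L - 1)" using row(7)[OF j(1) j'] j(2) True by (simp add: pred)
        show ?thesis
        proof (cases "j = M i")
          case True
          then show ?thesis using c' by (simp add: L_def)
        next
          case False
          then have "climbed i (j + 1) = c" using row(7)[of "j + 1"] j j' row(3) c' by auto
          moreover have "j + 1 \<in> {1..int n}" using False j j' row(3) by auto
          ultimately show ?thesis by blast
        qed
      next
        case False
        then show ?thesis using j by (auto simp: pred)
      qed
    next
      assume "c \<in> climbed i ` {1..int n} \<or> c = k i"
      then show "c \<in> climbed (i - 1) ` {1..int n}"
      proof
        assume "c \<in> climbed i ` {1..int n}"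
        then obtain j where j: "j \<in> {1..int n}" "c = climbed i j" by auto
        show ?thesis
        proof (cases "hit m n x i j")
          case True
          then have j': "L < j" "j \<le> M i" by (auto simp: hit)
          have c': "c = x i + (j - L - 1)" using row(7)[OF j(1) j'] j by simp
          then have "L < j - 1" using c by simp
          then have "hit m n x i (j - 1)" "j - 1 \<in> {1..int n}" "climbed i (j - 1) = c - 1"
            using row(7)[of "j - 1"] row(1) j j' c' by (auto simp: hit)
          then show ?thesis by (auto simp: pred intro!: image_eqI[of _ _ "j - 1"])
        next
          case False
          then show ?thesis using j by (auto simp: pred)
        qed
      next
        assume "c = k i"
        then have "L < M i" using c by (simp add: L_def)
        moreover have "M i \<in> {1..int n}" using calculation row(1,3) by auto
        ultimately have "hit m n x i (M i)" "M i \<in> {1..int n}" "climbed i (M i) = c - 1"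
          using row(7)[of "M i"] \<open>c = k i\<close> by (auto simp: hit L_def)
        then show ?thesis by (auto simp: pred intro!: image_eqI[of _ _ "M i"])
      qed
    qed
    moreover have "i < int m \<longrightarrow> x (i + 1) < c" using c x_dec[of i] i by auto
    then have "c \<in> climbed i ` {1..int n} \<longleftrightarrow> c \<in> y ` {1..int n} \<union> k ` {i<..int m}"
      using inv unfolding inv_at_def by blast
    moreover have "{i - 1<..int m} = insert i {i<..int m}" using i by auto
    ultimately show ?thesis by auto
  qed
  moreover have "climbed (i - 1) j \<le> k i" if j: "j \<in> {1..int n}" "climbed (i - 1) j \<noteq> y j" for j
  proof (cases "hit m n x i j")
    case True
    then show ?thesis using row(5)[OF j(1)] by (simp add: pred hit)
  next
    case False
    then have "i < int m" "climbed i j \<le> k (i + 1)"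
      using inv j unfolding inv_at_def by (auto simp: pred)
    then show ?thesis using arrow_end_step[of i] i False by (simp add: pred)
  qed
  ultimately show ?thesis using i by (simp add: inv_at_def)
qed

private lemma inv_all:
  assumes "i \<in> {0..int m}"
  shows "inv_at i"
proof -
  have "i \<le> int m" using assms by simp
  then have "0 \<le> i \<longrightarrow> inv_at i"
  proof (induction i rule: int_le_induct)
    case base
    have "climbed (int m) = y" by (simp add: climbed_def fun_eq_iff)
    then show ?case using y_inc by (auto simp: inv_at_def)
  next
    case (step i)
    then show ?case using inv_step[of i] by auto
  qed
  then show ?thesis using assms by simp
qed

text \<open>The right-hand side is \<open>climbed i j\<close>. For \<open>j\<close> up to
  \<open>L\<close> it is below \<open>x i\<close>; for \<open>j\<close> in the run both sides agree;
  beyond \<open>M i\<close> the left-hand side is \<open>k i\<close>, a value that no climbed value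
  takes.\<close>

lemma hit_recursion:
  assumes i: "i \<in> {1..int m}" and j: "j \<in> {1..int n}"
  shows "hit m n x i j \<longleftrightarrow>
    x i + int (card {j' \<in> {1..int n}. j' < j \<and> hit m n x i j'}) =
    - x (- j) + int (card {i' \<in> {1..int m}. i < i' \<and> hit m n x i' j})"
proof -
  define L where "L = M i - (k i - x i)"
  have "inv_at i" using inv_all i by simp
  note row = row_facts[OF i this, folded L_def]
  have hit: "hit m n x i j \<longleftrightarrow> L < j \<and> j \<le> M i" for j by (simp add: hit_iff L_def)
  have "{j' \<in> {1..int n}. j' < j \<and> hit m n x i j'} = {L + 1..min (j - 1) (M i)}"
    using row(1,3) j by (auto simp: hit)
  then have *: "int (card {j' \<in> {1..int n}. j' < j \<and> hit m n x i j'}) = max 0 (min (j - 1) (M i) - L)"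
    using row(2) by auto
  have "{i' \<in> {1..int m}. i < i' \<and> hit m n x i' j} = {i' \<in> {i<..int m}. hit m n x i' j}"
    using i by auto
  then have **: "- x (- j) + int (card {i' \<in> {1..int m}. i < i' \<and> hit m n x i' j}) = climbed i j"
    by (simp add: climbed_def)
  have ne: "climbed i j \<noteq> k i" using row(4) j by (metis imageI)
  then show ?thesis unfolding * **
    using hit[of j] row(2) row(5)[OF j] row(6)[OF j] row(7)[OF j] L_def ne by linarith
qed

end


section \<open>Shifted highest weights along odd reflections\<close>

lemma swap_less_iff:
  assumes p: "placement m n p" and ab: "a \<in> idx m n" "b \<in> idx m n" "p b = p a + 1"
    and cd: "c \<in> idx m n" "d \<in> idx m n" "\<not> (c = a \<and> d = b)" "\<not> (c = b \<and> d = a)"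
  shows "(p(a := p b, b := p a)) c < (p(a := p b, b := p a)) d \<longleftrightarrow> p c < p d"
proof -
  have "p c = p a \<longleftrightarrow> c = a" "p c = p b \<longleftrightarrow> c = b" "p d = p a \<longleftrightarrow> d = a" "p d = p b \<longleftrightarrow> d = b"
    using placement_eq_iff[OF p cd(1) ab(1)] placement_eq_iff[OF p cd(1) ab(2)]
      placement_eq_iff[OF p cd(2) ab(1)] placement_eq_iff[OF p cd(2) ab(2)] by simp_all
  moreover have "a \<noteq> b" using ab(3) by auto
  \<comment> \<open>The places of \<open>a\<close> and \<open>b\<close> are consecutive, so every
    third index compares alike with both.\<close>
  ultimately show ?thesis
    using ab(3) cd(3,4)
    by (cases "c = a"; cases "c = b"; cases "d = a"; cases "d = b") (simp_all, linarith+)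
qed

lemma shuffle_swap:
  assumes p: "shuffle m n p" and ab: "a \<in> idx m n" "b \<in> idx m n" "p b = p a + 1" "(a < 0) \<noteq> (b < 0)"
  shows "shuffle m n (p(a := p b, b := p a))"
proof -
  let ?p' = "p(a := p b, b := p a)"
  have pl: "placement m n p" using p by (simp add: shuffle_def)
  have less: "?p' c < ?p' d" if "p c < p d" "c \<in> idx m n" "d \<in> idx m n" "(c < 0) = (d < 0)" for c d
    using swap_less_iff[OF pl ab(1-3) that(2,3)] that ab(4) by blast
  have "strict_mono_on {1..int m} ?p'"
    using p by (intro strict_mono_onI less) (auto simp: shuffle_def idx_def strict_mono_onD)
  moreover have "strict_mono_on {1..int n} (\<lambda>j. ?p' (- j))"
  proof (rule strict_mono_onI)
    fix r s assume "r \<in> {1..int n}" "s \<in> {1..int n}" "r < s"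
    moreover from this have "p (- r) < p (- s)"
      using p strict_mono_onD[of "{1..int n}" "\<lambda>j. p (- j)" r s] by (simp add: shuffle_def)
    ultimately show "?p' (- r) < ?p' (- s)" by (intro less) (auto simp: idx_def)
  qed
  ultimately show ?thesis using placement_swap[OF pl ab(1,2)] by (simp add: shuffle_def)
qed

section \<open>Coordinates of \<rho>\<close>

lemma sum_fun_apply: "(\<Sum>i\<in>A. f i) x = (\<Sum>i\<in>A. f i x)"
  for f :: "'a \<Rightarrow> 'b \<Rightarrow> 'c::comm_monoid_add"
  by (induction A rule: infinite_finite_induct) auto

text \<open>A positive root starting at \<open>a\<close> contributes 1 and one ending at
  \<open>a\<close> contributes -1, so each index \<open>c\<close> related to \<open>a\<close>
  contributes the sign of \<open>p c - p a\<close>. The relation \<open>Q\<close> selects the even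
  or the odd roots.\<close>

lemma sum_roots_apply:
  assumes a: "a \<in> idx m n" and inj: "inj_on p (idx m n)" and sym: "\<And>c d. Q c d \<longleftrightarrow> Q d c"
  shows "(\<Sum>\<gamma>\<in>{root_of c d | c d. c \<in> idx m n \<and> d \<in> idx m n \<and> p c < p d \<and> Q c d}. \<gamma>) a =
    of_int (\<Sum>c\<in>idx m n. if Q a c then sgn (p c - p a) else 0)"
proof -
  define S where "S = {t \<in> idx m n \<times> idx m n. p (fst t) < p (snd t) \<and> Q (fst t) (snd t)}"
  define g where "g t = root_of (fst t) (snd t)" for t
  have set: "{root_of c d | c d. c \<in> idx m n \<and> d \<in> idx m n \<and> p c < p d \<and> Q c d} = g ` S"
    by (force simp: S_def g_def image_iff)
  have inj_g: "inj_on g S"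
  proof (rule inj_onI)
    fix s t assume "s \<in> S" "t \<in> S" "g s = g t"
    moreover from this have "fst s \<noteq> snd s" by (auto simp: S_def)
    ultimately show "s = t" by (auto simp: g_def root_of_eq_iff prod_eq_iff)
  qed
  have "(\<Sum>\<gamma>\<in>g ` S. \<gamma>) a = (\<Sum>t\<in>S. g t a)"
    by (simp add: sum.reindex[OF inj_g] sum_fun_apply)
  also have "\<dots> = (\<Sum>t\<in>idx m n \<times> idx m n. if p (fst t) < p (snd t) \<and> Q (fst t) (snd t) then g t a else 0)"
    unfolding S_def by (rule sum.inter_filter) simp
  also have "\<dots> = (\<Sum>c\<in>idx m n. \<Sum>d\<in>idx m n. if p c < p d \<and> Q c d then root_of c d a else 0)"
    unfolding g_def by (simp only: sum.cartesian_product split_def)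
  also have "\<dots> = (\<Sum>c\<in>idx m n. \<Sum>d\<in>idx m n. (if c = a then of_bool (p a < p d \<and> Q a d) else 0) -
      (if d = a then of_bool (p c < p a \<and> Q c a) else 0))"
    by (intro sum.cong refl) (auto simp: root_of_def)
  also have "\<dots> = (\<Sum>c\<in>idx m n. \<Sum>d\<in>idx m n. if c = a then of_bool (p a < p d \<and> Q a d) else 0) -
      (\<Sum>c\<in>idx m n. of_bool (p c < p a \<and> Q c a))"
    using a by (simp add: sum_subtractf)
  also have "(\<Sum>c\<in>idx m n. \<Sum>d\<in>idx m n. if c = a then of_bool (p a < p d \<and> Q a d) else 0) =
      (\<Sum>d\<in>idx m n. of_bool (p a < p d \<and> Q a d) :: complex)"
    using a by (subst sum.swap) simp
  also have "\<dots> - (\<Sum>c\<in>idx m n. of_bool (p c < p a \<and> Q c a)) =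
      (\<Sum>c\<in>idx m n. of_int (if Q a c then sgn (p c - p a) else 0))"
    unfolding sum_subtractf[symmetric] using sym[of _ a] by (intro sum.cong) (auto simp: sgn_if)
  finally show ?thesis unfolding set by simp
qed

lemma rho_apply:
  assumes p: "placement m n p" and a: "a \<in> idx m n"
  shows "rho m n (adjacent_roots m n p) a =
    of_int (\<Sum>c\<in>idx m n. (if (a < 0) = (c < 0) then 1 else -1) * sgn (p c - p a)) / 2 + rho_shift m n a"
proof -
  note inj = placement_inj[OF p]
  have inter: "positive_roots m n p \<inter> {root_of c d | c d. c \<in> idx m n \<and> d \<in> idx m n \<and> c \<noteq> d \<and> Q c d} =
      {root_of c d | c d. c \<in> idx m n \<and> d \<in> idx m n \<and> p c < p d \<and> Q c d}" for Q
  proof (intro set_eqI iffI)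
    fix \<gamma>
    assume \<gamma>: "\<gamma> \<in> positive_roots m n p \<inter>
      {root_of c d | c d. c \<in> idx m n \<and> d \<in> idx m n \<and> c \<noteq> d \<and> Q c d}"
    then obtain c d where "\<gamma> = root_of c d" "Q c d" by blast
    with \<gamma> show "\<gamma> \<in> {root_of c d | c d. c \<in> idx m n \<and> d \<in> idx m n \<and> p c < p d \<and> Q c d}"
      using root_of_in_positive_roots by blast
  next
    fix \<gamma> assume "\<gamma> \<in> {root_of c d | c d. c \<in> idx m n \<and> d \<in> idx m n \<and> p c < p d \<and> Q c d}"
    then obtain c d where "\<gamma> = root_of c d" "c \<in> idx m n" "d \<in> idx m n" "p c < p d" "Q c d" by blast
    moreover from this have "c \<noteq> d" by auto
    ultimately show "\<gamma> \<in> positive_roots m n p \<inter>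
        {root_of c d | c d. c \<in> idx m n \<and> d \<in> idx m n \<and> c \<noteq> d \<and> Q c d}"
      by (auto simp: positive_roots_def)
  qed
  have even: "(\<Sum>\<gamma>\<in>positive_roots m n p \<inter> even_roots m n. \<gamma>) a =
      of_int (\<Sum>c\<in>idx m n. if (a < 0) = (c < 0) then sgn (p c - p a) else 0)"
    unfolding even_roots_eq inter by (rule sum_roots_apply[OF a inj]) blast
  have "odd_roots m n =
      {root_of c d | c d. c \<in> idx m n \<and> d \<in> idx m n \<and> c \<noteq> d \<and> (c < 0) \<noteq> (d < 0)}"
    unfolding odd_roots_eq by blast
  then have odd: "(\<Sum>\<gamma>\<in>positive_roots m n p \<inter> odd_roots m n. \<gamma>) a =
      of_int (\<Sum>c\<in>idx m n. if (a < 0) \<noteq> (c < 0) then sgn (p c - p a) else 0)"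
    by (simp only: inter) (rule sum_roots_apply[OF a inj], blast)
  have "(\<Sum>c\<in>idx m n. (if (a < 0) = (c < 0) then 1 else -1) * sgn (p c - p a)) =
      (\<Sum>c\<in>idx m n. if (a < 0) = (c < 0) then sgn (p c - p a) else 0) -
      (\<Sum>c\<in>idx m n. if (a < 0) \<noteq> (c < 0) then sgn (p c - p a) else 0)"
    unfolding sum_subtractf[symmetric] by (rule sum.cong) auto
  then show ?thesis
    unfolding rho_def pos_roots_adjacent_roots[OF p]
    by (simp only: plus_fun_apply minus_apply weight_scale_def even odd of_int_diff)
      (simp add: diff_divide_distrib)
qed

text \<open>Coordinate form of (\<rho>|\<alpha>) = (\<alpha>|\<alpha>)/2 for a simple root \<alpha>.
  Third indices lie on the same side of both neighbours and cancel, which leaves the contributions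
  of \<open>a\<close> and \<open>b\<close> to each other.\<close>

lemma rho_adjacent:
  assumes p: "placement m n p" and ab: "a \<in> idx m n" "b \<in> idx m n" "p b = p a + 1"
  shows "(a < 0) = (b < 0) \<Longrightarrow> rho m n (adjacent_roots m n p) a - rho m n (adjacent_roots m n p) b = 1"
    and "(a < 0) \<noteq> (b < 0) \<Longrightarrow> rho m n (adjacent_roots m n p) a + rho m n (adjacent_roots m n p) b = 0"
proof -
  define f where "f a c = (if (a < 0) = (c < 0) then 1 else -1) * sgn (p c - p a)" for a c
  have sgn: "sgn (p c - p a) = sgn (p c - p b)" if "c \<in> idx m n" "c \<noteq> a" "c \<noteq> b" for c
  proof -
    have "p c \<noteq> p a" "p c \<noteq> p b"
      using placement_eq_iff[OF p that(1) ab(1)] placement_eq_iff[OF p that(1) ab(2)] that by simp_all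
    then show ?thesis using ab(3) by (auto simp: sgn_if)
  qed
  have neq: "a \<noteq> b" using ab by auto
  note rho = rho_apply[OF p ab(1), folded f_def] rho_apply[OF p ab(2), folded f_def]
  have shift: "rho_shift m n a = (if (a < 0) = (b < 0) then rho_shift m n b else - rho_shift m n b)"
    using ab by (auto simp: rho_shift_def idx_def Let_def)
  {
    assume same: "(a < 0) = (b < 0)"
    have "(\<Sum>c\<in>idx m n. f a c) - (\<Sum>c\<in>idx m n. f b c) =
        (\<Sum>c\<in>idx m n. (if c = a then 1 else 0) + (if c = b then 1 else 0))"
      unfolding sum_subtractf[symmetric]
      by (rule sum.cong) (use same sgn neq ab in \<open>auto simp: f_def sgn_if\<close>)
    also have "\<dots> = 2" using ab by (simp add: sum.distrib)
    finally have "(\<Sum>c\<in>idx m n. f a c) = (\<Sum>c\<in>idx m n. f b c) + 2" by simp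
    then show "rho m n (adjacent_roots m n p) a - rho m n (adjacent_roots m n p) b = 1"
      unfolding rho using shift same by (simp add: add_divide_distrib)
  next
    assume diff: "(a < 0) \<noteq> (b < 0)"
    have "(\<Sum>c\<in>idx m n. f a c) + (\<Sum>c\<in>idx m n. f b c) =
        (\<Sum>c\<in>idx m n. (if c = a then 1 else 0) - (if c = b then 1 else 0))"
      unfolding sum.distrib[symmetric]
      by (rule sum.cong) (use diff sgn neq ab in \<open>auto simp: f_def sgn_if\<close>)
    also have "\<dots> = 0" using ab by (simp add: sum_subtractf)
    finally have "(\<Sum>c\<in>idx m n. f a c) = - (\<Sum>c\<in>idx m n. f b c)" by simp
    then show "rho m n (adjacent_roots m n p) a + rho m n (adjacent_roots m n p) b = 0"
      unfolding rho using shift diff by simp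
  }
qed

text \<open>Each of the other \<open>m + n - 1\<close> indices contributes 1 or -1, so the sum has
  the parity of \<open>m + n - 1\<close>. Its half fails to be an integer exactly when
  \<open>m + n\<close> is even, and then the shift by 1/2 repairs this.\<close>

lemma rho_Ints:
  assumes p: "placement m n p" and a: "a \<in> idx m n"
  shows "rho m n (adjacent_roots m n p) a \<in> \<int>"
proof -
  define f where "f c = (if (a < 0) = (c < 0) then 1 else -1) * sgn (p c - p a)" for c
  have odd: "even (f c + 1)" if "c \<in> idx m n - {a}" for c
  proof -
    have "p c \<noteq> p a" using placement_eq_iff[OF p] that a by auto
    then show ?thesis by (auto simp: f_def sgn_if)
  qed
  have "even (\<Sum>c\<in>idx m n - {a}. f c + 1)" by (intro dvd_sum odd)
  also have "(\<Sum>c\<in>idx m n - {a}. f c + 1) = (\<Sum>c\<in>idx m n. f c) + (int (m + n) - 1)"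
  proof -
    have "(\<Sum>c\<in>idx m n. f c) = (\<Sum>c\<in>idx m n - {a}. f c)"
      using a by (simp add: sum_diff1 f_def)
    moreover have "card (idx m n) = Suc (card (idx m n - {a}))" using a by (intro card_Suc_Diff1[symmetric]) simp
    then have "int (card (idx m n - {a})) = int (m + n) - 1" unfolding card_idx by simp
    ultimately show ?thesis by (simp add: sum.distrib)
  qed
  finally obtain N where N: "(\<Sum>c\<in>idx m n. f c) = 2 * N - int (m + n) + 1"
    by (metis add.commute add_diff_cancel_left' diff_add_eq diff_diff_eq2 dvdE)
  have rho: "rho m n (adjacent_roots m n p) a = of_int (\<Sum>c\<in>idx m n. f c) / 2 + rho_shift m n a"
    using rho_apply[OF p a] by (simp only: f_def)
  show ?thesis
  proof (cases "even (m + n)")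
    case True
    then obtain k where k: "m + n = 2 * k" by (rule evenE)
    have "rho_shift m n a = 1 / 2 \<or> rho_shift m n a = - 1 / 2"
      using True a by (auto simp: rho_shift_def Let_def idx_def)
    then have "rho m n (adjacent_roots m n p) a = of_int (N - int k + 1) \<or>
        rho m n (adjacent_roots m n p) a = of_int (N - int k)"
      unfolding rho N k by (auto simp: field_simps)
    then show ?thesis by (metis Ints_of_int)
  next
    case False
    then obtain k where k: "m + n = 2 * k + 1" by (rule oddE)
    have "rho_shift m n a = 0" using False by (auto simp: rho_shift_def Let_def)
    then have "rho m n (adjacent_roots m n p) a = of_int (N - int k)"
      unfolding rho N k by (simp add: field_simps)
    then show ?thesis by (metis Ints_of_int)
  qed
qed

text \<open>The swap replaces one positive odd root by its negative and keeps the other positive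
  roots. Half the sum of the odd ones drops by that root, and it enters \<rho> with a minus
  sign.\<close>

lemma rho_swap:
  assumes p: "placement m n p" and ab: "a \<in> idx m n" "b \<in> idx m n" "p b = p a + 1" "(a < 0) \<noteq> (b < 0)"
  shows "rho m n (adjacent_roots m n (p(a := p b, b := p a))) = rho m n (adjacent_roots m n p) + root_of a b"
proof -
  let ?p' = "p(a := p b, b := p a)"
  have p': "placement m n ?p'" by (rule placement_swap[OF p ab(1,2)])
  have neq: "a \<noteq> b" using ab by auto
  have ba: "root_of b a \<notin> positive_roots m n p" using ab by (simp add: root_of_in_positive_roots)
  have ab_in: "root_of a b \<in> positive_roots m n p" using ab by (simp add: root_of_in_positive_roots)
  have pos: "positive_roots m n ?p' = insert (root_of b a) (positive_roots m n p - {root_of a b})"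
  proof (intro set_eqI iffI)
    fix \<gamma> assume "\<gamma> \<in> positive_roots m n ?p'"
    then obtain c d where cd: "\<gamma> = root_of c d" "c \<in> idx m n" "d \<in> idx m n" "?p' c < ?p' d"
      by (auto simp: positive_roots_def)
    show "\<gamma> \<in> insert (root_of b a) (positive_roots m n p - {root_of a b})"
    proof (cases "c = b \<and> d = a")
      case False
      moreover have "\<not> (c = a \<and> d = b)" using cd(4) ab(3) neq by auto
      ultimately show ?thesis
        using swap_less_iff[OF p ab(1-3) cd(2,3)] cd root_of_eq_iff[OF neq, of c d]
        by (auto simp: root_of_in_positive_roots)
    qed (use cd in simp)
  next
    fix \<gamma> assume \<gamma>: "\<gamma> \<in> insert (root_of b a) (positive_roots m n p - {root_of a b})"
    show "\<gamma> \<in> positive_roots m n ?p'"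
    proof (cases "\<gamma> = root_of b a")
      case True
      have "?p' b < ?p' a" using ab neq by simp
      then show ?thesis using True ab by (simp only: root_of_in_positive_roots)
    next
      case False
      then obtain c d where cd: "\<gamma> = root_of c d" "c \<in> idx m n" "d \<in> idx m n" "p c < p d"
        using \<gamma> by (auto simp: positive_roots_def)
      then have "\<not> (c = a \<and> d = b)" "\<not> (c = b \<and> d = a)" using \<gamma> False by auto
      then have "?p' c < ?p' d" using swap_less_iff[OF p ab(1-3) cd(2,3)] cd(4) by blast
      then show ?thesis using cd by (simp only: root_of_in_positive_roots)
    qed
  qed
  have odd: "root_of a b \<in> odd_roots m n" "root_of b a \<in> odd_roots m n"
    using ab by (auto simp: odd_roots_eq)
  have not_even: "root_of a b \<notin> even_roots m n" "root_of b a \<notin> even_roots m n"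
    using ab neq root_of_eq_iff[OF neq] root_of_eq_iff[OF neq[symmetric]] by (auto simp: even_roots_eq)
  have even_eq: "positive_roots m n ?p' \<inter> even_roots m n = positive_roots m n p \<inter> even_roots m n"
    using pos not_even by auto
  have odd_eq: "positive_roots m n ?p' \<inter> odd_roots m n =
      insert (root_of b a) (positive_roots m n p \<inter> odd_roots m n - {root_of a b})"
    using pos odd by auto
  have fin: "finite (positive_roots m n p \<inter> odd_roots m n)"
    using finite_roots by (rule finite_subset[rotated]) (auto simp: roots_def)
  have "(\<Sum>\<gamma>\<in>positive_roots m n ?p' \<inter> odd_roots m n. \<gamma>) =
      root_of b a + ((\<Sum>\<gamma>\<in>positive_roots m n p \<inter> odd_roots m n. \<gamma>) - root_of a b)"
    unfolding odd_eq using fin ba ab_in odd by (simp add: sum_diff1)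
  also have "root_of b a = - root_of a b" by (simp add: uminus_root_of)
  finally have sum: "(\<Sum>\<gamma>\<in>positive_roots m n ?p' \<inter> odd_roots m n. \<gamma>) =
      - root_of a b + ((\<Sum>\<gamma>\<in>positive_roots m n p \<inter> odd_roots m n. \<gamma>) - root_of a b)" .
  show ?thesis
    unfolding rho_def pos_roots_adjacent_roots[OF p] pos_roots_adjacent_roots[OF p'] even_eq sum
    by (simp add: fun_eq_iff weight_scale_def algebra_simps)
qed

section \<open>Shifted coordinates along a sequence of swaps\<close>

text \<open>
  Here \<open>x\<close> stands for the coordinates of the shifted highest weight for the distinguished base, and each
  pair with \<open>hit m n x i j\<close> whose \<open>\<delta>\<^sub>j\<close> has passed \<open>\<epsilon>\<^sub>i\<close> contributes the root \<open>\<epsilon>\<^sub>i - \<delta>\<^sub>j\<close>.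
\<close>

definition shifted_coord :: "nat \<Rightarrow> nat \<Rightarrow> (int \<Rightarrow> int) \<Rightarrow> (int \<Rightarrow> int) \<Rightarrow> int \<Rightarrow> int" where
  "shifted_coord m n x p a =
     (if a < 0 then x a - int (card {i \<in> {1..int m}. p a < p i \<and> hit m n x i (- a)})
      else x a + int (card {j \<in> {1..int n}. p (- j) < p a \<and> hit m n x a j}))"

text \<open>The swap makes \<open>\<delta>\<^sub>j\<close> pass \<open>\<epsilon>\<^sub>i\<close>
  and changes no other comparison between the families, so only the pair \<open>(i, j)\<close> can
  join the counts.\<close>

lemma shifted_coord_swap:
  assumes p: "placement m n p" and i: "i \<in> {1..int m}" and j: "j \<in> {1..int n}"
    and adj: "p (- j) = p i + 1" and a: "a \<in> idx m n"
  shows "shifted_coord m n x (p(i := p (- j), - j := p i)) a =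
    shifted_coord m n x p a + (if hit m n x i j then of_bool (a = i) - of_bool (a = - j) else 0)"
proof -
  define p' where "p' = p(i := p (- j), - j := p i)"
  have ij: "i \<in> idx m n" "- j \<in> idx m n" using i j by (auto simp: idx_def)
  have less: "p' (- j') < p' i' \<longleftrightarrow> p (- j') < p i' \<or> i' = i \<and> j' = j"
    if "i' \<in> {1..int m}" "j' \<in> {1..int n}" for i' j'
  proof (cases "i' = i \<and> j' = j")
    case True
    then show ?thesis using adj i j by (auto simp: p'_def)
  next
    case False
    then show ?thesis
      using swap_less_iff[OF p ij adj, of "- j'" i', folded p'_def] that i j by (auto simp: idx_def)
  qed
  have "shifted_coord m n x p' a =
    shifted_coord m n x p a + (if hit m n x i j then of_bool (a = i) - of_bool (a = - j) else 0)"
  proof (cases "a < 0")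
    case True
    define j' where "j' = - a"
    have j': "j' \<in> {1..int n}" "a = - j'" using a True by (auto simp: idx_def j'_def)
    define A where "A = {i' \<in> {1..int m}. p (- j') < p i' \<and> hit m n x i' j'}"
    have "{i' \<in> {1..int m}. p' (- j') < p' i' \<and> hit m n x i' j'} =
        (if j' = j \<and> hit m n x i j then insert i A else A)"
      using less j' i by (auto simp: A_def split: if_splits)
    moreover have "i \<notin> A" if "j' = j" using adj that by (auto simp: A_def)
    moreover have "finite A" by (rule finite_subset[of _ "{1..int m}"]) (auto simp: A_def)
    ultimately have "card {i' \<in> {1..int m}. p' (- j') < p' i' \<and> hit m n x i' j'} =
        card A + (if j' = j \<and> hit m n x i j then 1 else 0)"
      by (auto simp del: mem_Collect_eq)
    then show ?thesis
      using True j' i unfolding A_def shifted_coord_def by auto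
  next
    case False
    then have a': "a \<in> {1..int m}" using a by (auto simp: idx_def)
    define A where "A = {j' \<in> {1..int n}. p (- j') < p a \<and> hit m n x a j'}"
    have "{j' \<in> {1..int n}. p' (- j') < p' a \<and> hit m n x a j'} =
        (if a = i \<and> hit m n x i j then insert j A else A)"
      using less a' j by (auto simp: A_def split: if_splits)
    moreover have "j \<notin> A" if "a = i" using adj that by (auto simp: A_def)
    moreover have "finite A" by (rule finite_subset[of _ "{1..int n}"]) (auto simp: A_def)
    ultimately have "card {j' \<in> {1..int n}. p' (- j') < p' a \<and> hit m n x a j'} =
        card A + (if a = i \<and> hit m n x i j then 1 else 0)"
      by (auto simp del: mem_Collect_eq)
    then show ?thesis
      using False j a' unfolding A_def shifted_coord_def by auto
  qed
  then show ?thesis by (simp only: p'_def)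
qed

text \<open>If \<open>\<epsilon>\<^sub>i\<close> and \<open>\<delta>\<^sub>j\<close> are neighbours
  in a shuffle, the \<delta> before \<open>\<epsilon>\<^sub>i\<close> are those of index less than
  \<open>j\<close>, and the \<epsilon> after \<open>\<delta>\<^sub>j\<close> those of index greater
  than \<open>i\<close>. The counts thus lose their dependence on \<open>p\<close> and become those
  of \<open>hit_recursion\<close>.\<close>

lemma shifted_coord_sum_eq_0_iff:
  assumes x_dec: "\<And>i. 1 \<le> i \<Longrightarrow> i < int m \<Longrightarrow> x (i + 1) < x i"
    and y_inc: "strict_mono_on {1..int n} (\<lambda>j. - x (- j))"
    and p: "shuffle m n p" and i: "i \<in> {1..int m}" and j: "j \<in> {1..int n}" and adj: "p (- j) = p i + 1"
  shows "shifted_coord m n x p i + shifted_coord m n x p (- j) = 0 \<longleftrightarrow> hit m n x i j"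
proof -
  have pl: "placement m n p" and mono: "strict_mono_on {1..int m} p"
    "strict_mono_on {1..int n} (\<lambda>j. p (- j))" using p by (auto simp: shuffle_def)
  have "p (- j') < p i \<longleftrightarrow> j' < j" if "j' \<in> {1..int n}" for j'
  proof -
    have "p (- j') < p (- j) \<longleftrightarrow> j' < j" using strict_mono_on_less[OF mono(2) that j] .
    moreover have "p (- j') \<noteq> p i" using placement_eq_iff[OF pl, of "- j'" i] that i by (auto simp: idx_def)
    ultimately show ?thesis using adj by linarith
  qed
  then have 1: "{j' \<in> {1..int n}. p (- j') < p i \<and> hit m n x i j'} = {j' \<in> {1..int n}. j' < j \<and> hit m n x i j'}"
    by auto
  have "p (- j) < p i' \<longleftrightarrow> i < i'" if "i' \<in> {1..int m}" for i'
  proof -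
    have "p i < p i' \<longleftrightarrow> i < i'" using strict_mono_on_less[OF mono(1) i that] .
    moreover have "p (- j) \<noteq> p i'" using placement_eq_iff[OF pl, of "- j" i'] that j by (auto simp: idx_def)
    ultimately show ?thesis using adj by linarith
  qed
  then have 2: "{i' \<in> {1..int m}. p (- j) < p i' \<and> hit m n x i' j} = {i' \<in> {1..int m}. i < i' \<and> hit m n x i' j}"
    by auto
  have "shifted_coord m n x p i = x i + int (card {j' \<in> {1..int n}. j' < j \<and> hit m n x i j'})"
    using i unfolding shifted_coord_def 1 by simp
  moreover have "shifted_coord m n x p (- j) = x (- j) - int (card {i' \<in> {1..int m}. i < i' \<and> hit m n x i' j})"
    using j 2 by (simp add: shifted_coord_def)
  ultimately show ?thesis using hit_recursion[OF x_dec y_inc i j] by linarith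
qed

section \<open>Induction on the number of inversions\<close>

definition inversions :: "nat \<Rightarrow> nat \<Rightarrow> (int \<Rightarrow> int) \<Rightarrow> (int \<times> int) set" where
  "inversions m n p = {t \<in> {1..int m} \<times> {1..int n}. p (- snd t) < p (fst t)}"

text \<open>An inversion of least gap is adjacent: the index placed right after \<open>- j\<close>
  would otherwise form a closer inversion, with \<open>i\<close> if it is a \<delta> and with
  \<open>j\<close> if it is an \<epsilon>.\<close>

lemma adjacent_inversion:
  assumes p: "placement m n p" and ne: "inversions m n p \<noteq> {}"
  obtains i j where "i \<in> {1..int m}" "j \<in> {1..int n}" "p i = p (- j) + 1"
proof -
  define gap where "gap t = nat (p (fst t) - p (- snd t))" for t
  obtain t where t: "t \<in> inversions m n p" and min: "\<And>s. s \<in> inversions m n p \<Longrightarrow> gap t \<le> gap s"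
    using ne ex_has_least_nat[of "\<lambda>t. t \<in> inversions m n p" _ gap] by blast
  obtain i j where ij: "t = (i, j)" by (cases t)
  have i: "i \<in> {1..int m}" and j: "j \<in> {1..int n}" and less: "p (- j) < p i"
    using t ij by (auto simp: inversions_def)
  have "p i = p (- j) + 1"
  proof (rule ccontr)
    assume far: "p i \<noteq> p (- j) + 1"
    have "i \<in> idx m n" "- j \<in> idx m n" using i j by (auto simp: idx_def)
    then have "0 \<le> p (- j) + 1" "p (- j) + 1 < int (m + n)"
      using placement_range[OF p, of i] placement_range[OF p, of "- j"] less by auto
    then obtain c where c: "c \<in> idx m n" "p c = p (- j) + 1" using placement_surj[OF p] by metis
    show False
    proof (cases "c < 0")
      case True
      then have "(i, - c) \<in> inversions m n p" using c i less far by (auto simp: inversions_def idx_def)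
      then show False using min[of "(i, - c)"] c less far by (simp add: gap_def ij)
    next
      case False
      then have "(c, j) \<in> inversions m n p" using c j by (auto simp: inversions_def idx_def)
      then show False using min[of "(c, j)"] c less far by (simp add: gap_def ij)
    qed
  qed
  then show thesis using that i j by blast
qed

lemma no_inversion_less_iff:
  assumes p: "shuffle m n p" and none: "inversions m n p = {}" and ab: "a \<in> idx m n" "b \<in> idx m n"
  shows "p a < p b \<longleftrightarrow> dist_place m a < dist_place m b"
proof -
  have pl: "placement m n p" using p by (simp add: shuffle_def)
  have eps: "p i < p i' \<longleftrightarrow> i < i'" if "i \<in> {1..int m}" "i' \<in> {1..int m}" for i i'
    using p strict_mono_on_less[OF _ that, of p] by (simp add: shuffle_def)
  have delta: "p (- j) < p (- j') \<longleftrightarrow> j < j'" if "j \<in> {1..int n}" "j' \<in> {1..int n}" for j j'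
    using p strict_mono_on_less[OF _ that, of "\<lambda>j. p (- j)"] by (simp add: shuffle_def)
  have mixed: "p i < p (- j)" if "i \<in> {1..int m}" "j \<in> {1..int n}" for i j
  proof -
    have "(i, j) \<notin> inversions m n p" using none by simp
    then have "p i \<le> p (- j)" using that by (auto simp: inversions_def)
    moreover have "p i \<noteq> p (- j)" using placement_eq_iff[OF pl, of i "- j"] that by (auto simp: idx_def)
    ultimately show ?thesis by simp
  qed
  have a: "a < 0 \<Longrightarrow> - a \<in> {1..int n}" "\<not> a < 0 \<Longrightarrow> a \<in> {1..int m}"
    and b: "b < 0 \<Longrightarrow> - b \<in> {1..int n}" "\<not> b < 0 \<Longrightarrow> b \<in> {1..int m}"
    using ab by (auto simp: idx_def)
  show ?thesis
  proof (cases "a < 0"; cases "b < 0")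
    assume "a < 0" "b < 0"
    then show ?thesis using delta[OF a(1) b(1)] by (auto simp: dist_place_def)
  next
    assume "a < 0" "\<not> b < 0"
    then show ?thesis using mixed[OF b(2) a(1)] a b by (auto simp: dist_place_def)
  next
    assume "\<not> a < 0" "b < 0"
    then show ?thesis using mixed[OF a(2) b(1)] a b by (auto simp: dist_place_def)
  next
    assume "\<not> a < 0" "\<not> b < 0"
    then show ?thesis using eps[OF a(2) b(2)] by (auto simp: dist_place_def)
  qed
qed

text \<open>Undoing an adjacent inversion leads to a shuffle \<open>q\<close> with fewer inversions,
  and an odd reflection leads back to \<open>p\<close>. As \<rho> for \<open>q\<close> is orthogonal
  to the reflected root, the vanishing condition on the weight is the one on shifted coordinates,
  that is, a hit. At a hit the weight stays and \<rho> adds the root; otherwise the changes of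
  weight and \<rho> cancel.\<close>

lemma (in gl_supermodule) shuffle_highest_vec:
  assumes simple: "\<And>W. gl_submodule scale m n V act W \<Longrightarrow> W = {0} \<or> W = UNIV"
    and lam: "highest_vec (dist_place m) lam v" "lam \<in> weights m n"
    and x: "\<And>a. a \<in> idx m n \<Longrightarrow> lam a + rho m n (dist_base m n) a = of_int (x a)"
    and x_dec: "\<And>i. 1 \<le> i \<Longrightarrow> i < int m \<Longrightarrow> x (i + 1) < x i"
    and y_inc: "strict_mono_on {1..int n} (\<lambda>j. - x (- j))"
    and "shuffle m n p"
  shows "\<exists>\<mu> v. \<mu> \<in> weights m n \<and> highest_vec p \<mu> v \<and>
    (\<forall>a\<in>idx m n. \<mu> a + rho m n (adjacent_roots m n p) a = of_int (shifted_coord m n x p a))"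
  using assms(7)
proof (induction "card (inversions m n p)" arbitrary: p rule: less_induct)
  case less
  note p = \<open>shuffle m n p\<close>
  have pl: "placement m n p" using p by (simp add: shuffle_def)
  show ?case
  proof (cases "inversions m n p = {}")
    case True
    note iff = no_inversion_less_iff[OF p True]
    have "positive_roots m n p = positive_roots m n (dist_place m)"
      using iff unfolding positive_roots_def by blast
    then have "rho m n (adjacent_roots m n p) = rho m n (dist_base m n)"
      using pos_roots_adjacent_roots[OF pl] pos_roots_adjacent_roots[of m n "dist_place m"] shuffle_dist_place
      by (simp add: rho_def dist_base_eq shuffle_def)
    moreover have "shifted_coord m n x p a = x a" if "a \<in> idx m n" for a
    proof -
      have none: "\<not> p (- j) < p i" if "i \<in> {1..int m}" "j \<in> {1..int n}" for i j
        using True that by (auto simp: inversions_def)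
      have "{i \<in> {1..int m}. p a < p i \<and> hit m n x i (- a)} = {}" if "a < 0"
        using none[of _ "- a"] that \<open>a \<in> idx m n\<close> by (auto simp: idx_def)
      moreover have "{j \<in> {1..int n}. p (- j) < p a \<and> hit m n x a j} = {}" if "\<not> a < 0"
        using none[of a] that \<open>a \<in> idx m n\<close> by (auto simp: idx_def)
      ultimately show ?thesis by (simp add: shifted_coord_def del: Collect_empty_eq)
    qed
    moreover have "highest_vec p lam v" using lam(1) iff by (simp add: highest_vec_def)
    ultimately show ?thesis using lam(2) x by (intro exI[of _ lam] exI[of _ v]) simp
  next
    case False
    then obtain i j where i: "i \<in> {1..int m}" and j: "j \<in> {1..int n}" and adj: "p i = p (- j) + 1"
      using adjacent_inversion[OF pl] by metis
    have ij: "i \<in> idx m n" "- j \<in> idx m n" "(i < 0) \<noteq> (- j < 0)" using i j by (auto simp: idx_def)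
    define q where "q = p(- j := p i, i := p (- j))"
    have q: "shuffle m n q" unfolding q_def using ij adj by (intro shuffle_swap[OF p]) auto
    have qpl: "placement m n q" using q by (simp add: shuffle_def)
    have q_adj: "q (- j) = q i + 1" using adj i j by (auto simp: q_def)
    have p_eq: "p = q(i := q (- j), - j := q i)" using i j by (auto simp: q_def fun_eq_iff)
    have "inversions m n q \<subset> inversions m n p"
    proof
      show "inversions m n q \<subseteq> inversions m n p"
      proof
        fix t assume t: "t \<in> inversions m n q"
        then have t': "fst t \<in> idx m n" "- snd t \<in> idx m n" by (auto simp: inversions_def idx_def)
        have "\<not> (- snd t = - j \<and> fst t = i)" using t q_adj by (auto simp: inversions_def)
        moreover have "\<not> (- snd t = i \<and> fst t = - j)" using t i j by (auto simp: inversions_def)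
        ultimately show "t \<in> inversions m n p"
          using t swap_less_iff[OF pl ij(2,1) adj t'(2,1)] by (auto simp: inversions_def q_def)
      qed
      have "(i, j) \<in> inversions m n p" "(i, j) \<notin> inversions m n q"
        using i j adj q_adj by (auto simp: inversions_def)
      then show "inversions m n q \<noteq> inversions m n p" by blast
    qed
    moreover have "finite (inversions m n p)"
      by (rule finite_subset[of _ "{1..int m} \<times> {1..int n}"]) (auto simp: inversions_def)
    ultimately have "card (inversions m n q) < card (inversions m n p)" by (rule psubset_card_mono[rotated])
    then obtain \<mu> u where \<mu>: "\<mu> \<in> weights m n" "highest_vec q \<mu> u"
      and coord: "\<And>a. a \<in> idx m n \<Longrightarrow>
        \<mu> a + rho m n (adjacent_roots m n q) a = of_int (shifted_coord m n x q a)"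
      using less.hyps[OF _ q] by blast
    have "rho m n (adjacent_roots m n q) i + rho m n (adjacent_roots m n q) (- j) = 0"
      by (rule rho_adjacent(2)[OF qpl ij(1,2) q_adj ij(3)])
    moreover have "(\<mu> i + \<mu> (- j)) + (rho m n (adjacent_roots m n q) i + rho m n (adjacent_roots m n q) (- j)) =
        of_int (shifted_coord m n x q i + shifted_coord m n x q (- j))"
      unfolding of_int_add coord[OF ij(1), symmetric] coord[OF ij(2), symmetric] by (simp only: add_ac)
    ultimately have "\<mu> i + \<mu> (- j) = of_int (shifted_coord m n x q i + shifted_coord m n x q (- j))"
      by (simp only: add_0_right)
    then have zero: "\<mu> i + \<mu> (- j) = 0 \<longleftrightarrow> hit m n x i j"
      using shifted_coord_sum_eq_0_iff[OF x_dec y_inc q i j q_adj] by (metis of_int_eq_0_iff)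
    define \<mu>' where "\<mu>' = (if \<mu> i + \<mu> (- j) = 0 then \<mu> else \<mu> - root_of i (- j))"
    obtain u' where u': "highest_vec p \<mu>' u'" "\<mu>' \<in> weights m n"
      using odd_reflection_highest_vec[OF simple placement_inj[OF qpl] ij q_adj \<mu>(2,1)]
      unfolding \<mu>'_def p_eq[symmetric] by blast
    have "\<mu>' a + rho m n (adjacent_roots m n p) a = of_int (shifted_coord m n x p a)" if a: "a \<in> idx m n" for a
    proof -
      have rho: "rho m n (adjacent_roots m n p) = rho m n (adjacent_roots m n q) + root_of i (- j)"
        using rho_swap[OF qpl ij(1,2) q_adj ij(3)] by (simp only: p_eq[symmetric])
      have "shifted_coord m n x p a =
          shifted_coord m n x q a + (if hit m n x i j then of_bool (a = i) - of_bool (a = - j) else 0)"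
        using shifted_coord_swap[OF qpl i j q_adj a, of x] by (simp only: p_eq[symmetric])
      then show ?thesis
        unfolding rho using coord[OF a] zero by (auto simp: \<mu>'_def root_of_def algebra_simps)
    qed
    then show ?thesis using u' by blast
  qed
qed

section \<open>Comparing weight diagrams\<close>

lemma count_Times_diagram_of:
  "count (diagram_of m n \<mu> p) Times =
    min (card {i \<in> {1..int m}. \<mu> i = of_int p}) (card {j \<in> {1..int n}. \<mu> (- j) = - of_int p})"
  by (auto simp: diagram_of_def Let_def)

lemma diagram_of_cong:
  assumes "\<And>a. a \<in> idx m n \<Longrightarrow> \<mu> a = \<nu> a"
  shows "diagram_of m n \<mu> = diagram_of m n \<nu>"
proof
  fix p
  have "{i \<in> {1..int m}. \<mu> i = of_int p} = {i \<in> {1..int m}. \<nu> i = of_int p}"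
    "{j \<in> {1..int n}. \<mu> (- j) = - of_int p} = {j \<in> {1..int n}. \<nu> (- j) = - of_int p}"
    using assms by (auto simp: idx_def)
  then show "diagram_of m n \<mu> p = diagram_of m n \<nu> p" unfolding diagram_of_def by metis
qed

text \<open>The coordinates \<open>i\<close> and \<open>- j\<close> leave position \<open>p\<close>
  and nothing arrives there, so both counts at \<open>p\<close> drop by one, and with them the
  number of symbols \<open>Times\<close>.\<close>

lemma diagram_of_move:
  assumes i: "i \<in> {1..int m}" and j: "j \<in> {1..int n}"
    and \<mu>: "\<mu> i = of_int p" "\<mu> (- j) = - of_int p"
    and \<nu>: "\<And>a. a \<in> idx m n \<Longrightarrow> \<nu> a = \<mu> a + root_of i (- j) a"
  shows "diagram_of m n \<nu> \<noteq> diagram_of m n \<mu>"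
proof
  assume eq: "diagram_of m n \<nu> = diagram_of m n \<mu>"
  let ?A = "{i' \<in> {1..int m}. \<mu> i' = of_int p}" and ?B = "{j' \<in> {1..int n}. \<mu> (- j') = - of_int p}"
  have val: "\<nu> i' = (if i' = i then of_int p + 1 else \<mu> i')" if "i' \<in> {1..int m}" for i'
    using \<nu>[of i'] \<mu> i j that by (auto simp: root_of_def idx_def)
  have "{i' \<in> {1..int m}. \<nu> i' = of_int p} = ?A - {i}"
    using val by (auto split: if_splits)
  moreover
  have val': "\<nu> (- j') = (if j' = j then - of_int p - 1 else \<mu> (- j'))" if "j' \<in> {1..int n}" for j'
    using \<nu>[of "- j'"] \<mu> i j that by (auto simp: root_of_def idx_def)
  have "{j' \<in> {1..int n}. \<nu> (- j') = - of_int p} = ?B - {j}"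
    using val' by (auto split: if_splits)
  ultimately have "min (card (?A - {i})) (card (?B - {j})) = min (card ?A) (card ?B)"
    using count_Times_diagram_of[of m n \<nu> p] count_Times_diagram_of[of m n \<mu> p] eq by simp
  moreover have "card (?A - {i}) < card ?A" "card (?B - {j}) < card ?B"
    using i j \<mu> by (intro card_Diff1_less; auto intro: finite_subset[of _ "{1..int m}"] finite_subset[of _ "{1..int n}"])+
  ultimately show False by linarith
qed

text \<open>The order consists of the \<epsilon> before \<open>\<epsilon>\<^sub>i\<close>, the
  \<delta> before \<open>\<delta>\<^sub>j\<close>, then \<open>\<epsilon>\<^sub>i\<close>,
  \<open>\<delta>\<^sub>j\<close>, the remaining \<epsilon> and the remaining \<delta>.\<close>

lemma ex_shuffle_adjacent:
  assumes i: "i \<in> {1..int m}" and j: "j \<in> {1..int n}"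
  obtains p where "shuffle m n p" "p (- j) = p i + 1"
proof -
  define p where "p a = (if a < 0 then (if - a < j then i - a - 2 else if - a = j then i + j - 1 else int m - a - 1)
      else (if a < i then a - 1 else if a = i then i + j - 2 else a + j - 1))" for a
  have "placement m n p"
    using i j by (intro placementI) (auto simp: p_def inj_on_def idx_def split: if_splits)
  moreover have "strict_mono_on {1..int m} p"
    using i j by (intro strict_mono_onI) (auto simp: p_def)
  moreover have "strict_mono_on {1..int n} (\<lambda>j. p (- j))"
    using i j by (intro strict_mono_onI) (auto simp: p_def)
  moreover have "p (- j) = p i + 1" using i j by (auto simp: p_def)
  ultimately show thesis using that by (auto simp: shuffle_def)
qed

section \<open>Transfer to the highest weights of the given module\<close>

lemma has_highest_weight_iff:
  assumes "gl_supermodule scale m n V act" "placement m n p"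
  shows "has_highest_weight scale m n act (adjacent_roots m n p) \<mu> \<longleftrightarrow>
    \<mu> \<in> weights m n \<and> (\<exists>v. gl_supermodule.highest_vec scale m n act p \<mu> v)"
proof -
  interpret gl_supermodule scale m n V act by fact
  show ?thesis
    unfolding has_highest_weight_def highest_vec_def weight_vec_def
      pos_roots_adjacent_roots[OF assms(2)] root_of_in_positive_roots by blast
qed

lemma highest_weight_eq:
  assumes simple: "simple_fd_gl_supermodule scale m n V act" and p: "placement m n p"
    and \<mu>: "has_highest_weight scale m n act (adjacent_roots m n p) \<mu>"
  shows "highest_weight scale m n act (adjacent_roots m n p) = \<mu>"
proof -
  have gl: "gl_supermodule scale m n V act"
    and sub: "\<And>W. gl_submodule scale m n V act W \<Longrightarrow> W = {0} \<or> W = UNIV"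
    using simple by (auto simp: simple_fd_gl_supermodule_def)
  interpret gl_supermodule scale m n V act by (rule gl)
  show ?thesis
    unfolding highest_weight_def
    using \<mu> highest_weight_unique[OF sub placement_inj[OF p]]
    by (intro the_equality) (auto simp: has_highest_weight_iff[OF gl p])
qed

text \<open>Dominance makes the coordinates weakly decreasing in each family, and \<rho> drops by
  exactly one at every step, which makes them strictly decreasing.\<close>

lemma shifted_dist_coords:
  assumes lam: "lam \<in> dominant_weights m n"
  defines "\<mu> \<equiv> lam + rho m n (dist_base m n)"
  shows "\<And>a. a \<in> idx m n \<Longrightarrow> \<mu> a = of_int (int_coord \<mu> a)"
    and "\<And>i. 1 \<le> i \<Longrightarrow> i < int m \<Longrightarrow> int_coord \<mu> (i + 1) < int_coord \<mu> i"
    and "strict_mono_on {1..int n} (\<lambda>j. - int_coord \<mu> (- j))"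
proof -
  have pl: "placement m n (dist_place m)" using shuffle_dist_place by (simp add: shuffle_def)
  show int: "\<mu> a = of_int (int_coord \<mu> a)" if a: "a \<in> idx m n" for a
  proof -
    have "lam a \<in> \<int>" using lam a by (simp add: dominant_weights_def)
    then have "\<mu> a \<in> \<int>"
      using rho_Ints[OF pl a] by (simp add: \<mu>_def dist_base_eq)
    then show ?thesis by (auto simp: int_coord_def elim: Ints_cases)
  qed
  have step: "int_coord \<mu> b < int_coord \<mu> a"
    if ab: "a \<in> idx m n" "b \<in> idx m n" "dist_place m b = dist_place m a + 1" "(a < 0) = (b < 0)"
      and le: "Re (lam b) \<le> Re (lam a)" for a b
  proof -
    have "rho m n (dist_base m n) a = rho m n (dist_base m n) b + 1"
      using rho_adjacent(1)[OF pl ab(1-4)] by (simp add: dist_base_eq algebra_simps)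
    then have "Re (\<mu> b) < Re (\<mu> a)" using le by (simp add: \<mu>_def)
    then show ?thesis unfolding int[OF ab(1)] int[OF ab(2)] by simp
  qed
  show "int_coord \<mu> (i + 1) < int_coord \<mu> i" if "1 \<le> i" "i < int m" for i
    using lam that by (intro step) (auto simp: idx_def dist_place_def dominant_weights_def)
  have delta: "int_coord \<mu> (- (j + 1)) < int_coord \<mu> (- j)" if "1 \<le> j" "j < int n" for j
    using lam that by (intro step) (auto simp: idx_def dist_place_def dominant_weights_def)
  show "strict_mono_on {1..int n} (\<lambda>j. - int_coord \<mu> (- j))"
  proof (rule strict_mono_onI)
    fix r s assume rs: "r \<in> {1..int n}" "s \<in> {1..int n}" "r < s"
    have "s \<le> int n \<longrightarrow> int_coord \<mu> (- s) < int_coord \<mu> (- r)" if "r + 1 \<le> s" for s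
      using that
    proof (induction s rule: int_ge_induct)
      case base
      then show ?case using delta[of r] rs by auto
    next
      case (step s)
      then show ?case using delta[of s] rs by auto
    qed
    then show "- int_coord \<mu> (- r) < - int_coord \<mu> (- s)" using rs by auto
  qed
qed

text \<open>At a hit the two shifted coordinates are opposite and both move, so the diagram changes.
  Without a hit the shifted weights before and after the reflection agree on all indices.\<close>

lemma weight_diagram_odd_reflection:
  assumes lam: "lam \<in> dominant_weights m n"
    and simple: "simple_fd_gl_supermodule scale m n V act"
    and hw: "has_highest_weight scale m n act (dist_base m n) lam"
    and p: "shuffle m n p" and i: "i \<in> {1..int m}" and j: "j \<in> {1..int n}" and adj: "p (- j) = p i + 1"
  defines "x \<equiv> int_coord (shifted_highest_weight scale m n act (dist_base m n))"
  shows "weight_diagram scale m n act (odd_reflection m n (eps i - delta j) (adjacent_roots m n p)) \<noteq>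
      weight_diagram scale m n act (adjacent_roots m n p) \<longleftrightarrow> hit m n x i j"
proof -
  let ?\<mu> = "shifted_highest_weight scale m n act"
  have gl: "gl_supermodule scale m n V act"
    and sub: "\<And>W. gl_submodule scale m n V act W \<Longrightarrow> W = {0} \<or> W = UNIV"
    using simple by (auto simp: simple_fd_gl_supermodule_def)
  interpret gl_supermodule scale m n V act by (rule gl)
  have dist: "placement m n (dist_place m)" using shuffle_dist_place by (simp add: shuffle_def)
  obtain v where v: "highest_vec (dist_place m) lam v" "lam \<in> weights m n"
    using hw by (auto simp: dist_base_eq has_highest_weight_iff[OF gl dist])
  have "?\<mu> (dist_base m n) = lam + rho m n (dist_base m n)"
    using highest_weight_eq[OF simple dist] hw by (simp add: shifted_highest_weight_def dist_base_eq)
  note coords = shifted_dist_coords[OF lam, folded this, folded x_def]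
  have x: "lam a + rho m n (dist_base m n) a = of_int (x a)" if "a \<in> idx m n" for a
    using coords(1)[OF that] \<open>?\<mu> (dist_base m n) = _\<close> by simp
  have shifted: "?\<mu> (adjacent_roots m n q) a = of_int (shifted_coord m n x q a)"
    if q: "shuffle m n q" and a: "a \<in> idx m n" for q a
  proof -
    have pl: "placement m n q" using q by (simp add: shuffle_def)
    obtain \<mu> u where "\<mu> \<in> weights m n" "highest_vec q \<mu> u" and
      coord: "\<forall>a\<in>idx m n. \<mu> a + rho m n (adjacent_roots m n q) a = of_int (shifted_coord m n x q a)"
      using shuffle_highest_vec[OF sub v x coords(2,3) q] by blast
    then have "has_highest_weight scale m n act (adjacent_roots m n q) \<mu>"
      by (auto simp: has_highest_weight_iff[OF gl pl])
    from highest_weight_eq[OF simple pl this] show ?thesis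
      using coord a by (simp add: shifted_highest_weight_def)
  qed
  define q where "q = p(i := p (- j), - j := p i)"
  have ij: "i \<in> idx m n" "- j \<in> idx m n" "(i < 0) \<noteq> (- j < 0)" using i j by (auto simp: idx_def)
  have pl: "placement m n p" using p by (simp add: shuffle_def)
  have q: "shuffle m n q" unfolding q_def by (rule shuffle_swap[OF p ij(1,2) adj ij(3)])
  have refl: "odd_reflection m n (eps i - delta j) (adjacent_roots m n p) = adjacent_roots m n q"
    unfolding eps_diff_delta q_def using i j adj by (intro odd_reflection_adjacent_roots[OF pl]) auto
  have change: "shifted_coord m n x q a =
      shifted_coord m n x p a + (if hit m n x i j then of_bool (a = i) - of_bool (a = - j) else 0)"
    if "a \<in> idx m n" for a
    unfolding q_def by (rule shifted_coord_swap[OF pl i j adj that])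
  show ?thesis
    unfolding refl weight_diagram_def
  proof (cases "hit m n x i j")
    case True
    have "shifted_coord m n x p i + shifted_coord m n x p (- j) = 0"
      using shifted_coord_sum_eq_0_iff[OF coords(2,3) p i j adj] True by simp
    then have "shifted_coord m n x p (- j) = - shifted_coord m n x p i" by simp
    then have "diagram_of m n (?\<mu> (adjacent_roots m n q)) \<noteq> diagram_of m n (?\<mu> (adjacent_roots m n p))"
      using True ij
      by (intro diagram_of_move[OF i j, where p = "shifted_coord m n x p i"])
        (auto simp: shifted p q change root_of_def)
    with True show "diagram_of m n (?\<mu> (adjacent_roots m n q)) \<noteq> diagram_of m n (?\<mu> (adjacent_roots m n p)) \<longleftrightarrow>
        hit m n x i j" by simp
  next
    case False
    have "diagram_of m n (?\<mu> (adjacent_roots m n q)) = diagram_of m n (?\<mu> (adjacent_roots m n p))"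
      using False by (intro diagram_of_cong) (simp add: shifted p q change)
    with False show "diagram_of m n (?\<mu> (adjacent_roots m n q)) \<noteq> diagram_of m n (?\<mu> (adjacent_roots m n p)) \<longleftrightarrow>
        hit m n x i j" by simp
  qed
qed

section \<open>Independence of the base and the interval of hits\<close>

theorem theorem2:
  fixes m n :: nat
    and scale :: "complex \<Rightarrow> 'v::ab_group_add \<Rightarrow> 'v"
    and V :: "bool \<Rightarrow> 'v set"
    and act :: "supermatrix \<Rightarrow> 'v \<Rightarrow> 'v"
    and lam :: weight
  assumes "lam \<in> dominant_weights m n"
    and "simple_fd_gl_supermodule scale m n V act"
    and "has_highest_weight scale m n act (dist_base m n) lam"
  shows "let D = weight_diagram scale m n act;
             r = odd_reflection m n;
             x = int_coord (shifted_highest_weight scale m n act (dist_base m n));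
             k = arrow_end m n x;
             M = (\<lambda>i. int (arrow_count m n x i))
         in (\<forall>\<Sigma>\<in>std_bases m n. \<forall>\<Sigma>'\<in>std_bases m n. \<forall>\<alpha>\<in>\<Sigma> \<inter> \<Sigma>' \<inter> right_odd_roots m n.
               D (r \<alpha> \<Sigma>) \<noteq> D \<Sigma> \<longrightarrow> D (r \<alpha> \<Sigma>') \<noteq> D \<Sigma>') \<and>
            (\<forall>i\<in>{1..int m}. \<forall>j\<in>{1..int n}.
               (\<forall>\<Sigma>\<in>std_bases m n. eps i - delta j \<in> \<Sigma> \<longrightarrow> D (r (eps i - delta j) \<Sigma>) \<noteq> D \<Sigma>) \<longleftrightarrow>
               (M i - (k i - x i - 1) \<le> j \<and> j \<le> M i))"
proof -
  define x where "x = int_coord (shifted_highest_weight scale m n act (dist_base m n))"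
  let ?D = "weight_diagram scale m n act" and ?r = "odd_reflection m n"
  \<comment> \<open>The right-hand side does not mention the base, which is what the first claim
    needs.\<close>
  have key: "?D (?r (eps i - delta j) \<Sigma>) \<noteq> ?D \<Sigma> \<longleftrightarrow> hit m n x i j"
    if \<Sigma>: "\<Sigma> \<in> std_bases m n" and ij: "i \<in> {1..int m}" "j \<in> {1..int n}" and \<alpha>: "eps i - delta j \<in> \<Sigma>" for \<Sigma> i j
  proof -
    obtain p where p: "shuffle m n p" "\<Sigma> = adjacent_roots m n p" using \<Sigma> by (auto simp: std_bases_iff)
    then have "p (- j) = p i + 1" using \<alpha> by (simp add: eps_diff_delta root_of_in_adjacent_roots)
    from weight_diagram_odd_reflection[OF assms p(1) ij this] show ?thesis by (simp only: p(2) x_def)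
  qed
  \<comment> \<open>Some standard base contains the root, so the universally quantified condition
    (a) is not vacuous and yields a hit.\<close>
  have "\<exists>\<Sigma>\<in>std_bases m n. eps i - delta j \<in> \<Sigma>" if ij: "i \<in> {1..int m}" "j \<in> {1..int n}" for i j
  proof -
    obtain p where p: "shuffle m n p" "p (- j) = p i + 1" using ex_shuffle_adjacent[OF ij] by metis
    then have "eps i - delta j \<in> adjacent_roots m n p"
      using ij by (auto simp: eps_diff_delta root_of_in_adjacent_roots idx_def)
    moreover have "adjacent_roots m n p \<in> std_bases m n" using p(1) std_bases_iff by blast
    ultimately show ?thesis by blast
  qed
  then have "(\<forall>\<Sigma>\<in>std_bases m n. eps i - delta j \<in> \<Sigma> \<longrightarrow> ?D (?r (eps i - delta j) \<Sigma>) \<noteq> ?D \<Sigma>) \<longleftrightarrow> hit m n x i j"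
    if ij: "i \<in> {1..int m}" "j \<in> {1..int n}" for i j
    using key[OF _ ij] ij by blast
  moreover have "?D (?r \<alpha> \<Sigma>') \<noteq> ?D \<Sigma>'"
    if \<Sigma>: "\<Sigma> \<in> std_bases m n" "\<Sigma>' \<in> std_bases m n" and \<alpha>: "\<alpha> \<in> \<Sigma> \<inter> \<Sigma>' \<inter> right_odd_roots m n"
      and D: "?D (?r \<alpha> \<Sigma>) \<noteq> ?D \<Sigma>" for \<Sigma> \<Sigma>' \<alpha>
  proof -
    obtain i j where ij: "\<alpha> = eps i - delta j" "i \<in> {1..int m}" "j \<in> {1..int n}"
      using \<alpha> by (auto simp: right_odd_roots_def)
    then show ?thesis using key[OF \<Sigma>(1) ij(2,3)] key[OF \<Sigma>(2) ij(2,3)] \<alpha> D by blast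
  qed
  ultimately show ?thesis
    unfolding Let_def x_def[symmetric] hit_def by blast
qed

end
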